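(* Let $\mathcal{C}$ be a category. For a functor $F:\mathcal{C}\to\mathrm{Set}$, the following are equivalent. (a) $F$ is the left Kan extension of $F|_{\mathcal{B}}$ along the inclusion $\mathcal{B}\hookrightarrow\mathcal{C}$, for some small full subcategory $\mathcal{B}\subseteq\mathcal{C}$. (b) $F$ is the left Kan extension of a functor $\mathcal{B}\to\mathrm{Set}$ along a functor $\mathcal{B}\to\mathcal{C}$, for some small category $\mathcal{B}$. (c) $F$ is the left Kan extension of a small functor $\mathcal{B}\to\mathrm{Set}$ along some functor $\mathcal{B}\to\mathcal{C}$ (for some category $\mathcal{B}$, not necessarily small). (d) $F$ is small.
   Context: Categories are not required to be small unless stated. A functor $F:\mathcal{C}\to\mathrm{Set}$ is *small* if it is the (pointwise) colimit of a small diagram of representables, i.e. $F\simeq \operatorname{colim}_{J\in\mathcal{J}^{\mathrm{op}}}\mathrm{Hom}_{\mathcal{C}}(DJ,-)$ for some functor $D:\mathcal{J}\to\mathcal{C}$ with $\mathcal{J}$ small. *)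

theory Defs
  imports Main "HOL-Library.FuncSet"
begin

unbundle cardinal_syntax

section \<open>Size\<close>

text \<open>
  HOL has no proper classes, so sizes are measured against a cardinal \<open>\<kappa>\<close>, in the way one does
  with a Grothendieck universe: a set of any type is small if it has fewer than \<open>\<kappa>\<close> elements.
  The usual requirement that \<open>\<kappa>\<close> be uncountable is not imposed: besides the inaccessible cardinals,
  \<open>\<aleph>\<^sub>0\<close> is admitted, for which small means finite.
\<close>

definition universe_cardinal :: "'u rel \<Rightarrow> bool" where
  "universe_cardinal \<kappa> \<longleftrightarrow>
     Card_order \<kappa> \<and> cinfinite \<kappa> \<and> regularCard \<kappa> \<and>
     (\<forall>A :: 'u set. |A| <o \<kappa> \<longrightarrow> |Pow A| <o \<kappa>)"

definition small :: "'u rel \<Rightarrow> 'x set \<Rightarrow> bool" where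
  "small \<kappa> A \<longleftrightarrow> |A| <o \<kappa>"


section \<open>Categories, functors, natural transformations\<close>

text \<open>\<open>Comp C g f\<close> is the composite \<open>g \<circ> f\<close>.\<close>

record ('o, 'a) cat =
  Obj :: "'o set"
  Arr :: "'a set"
  Dom :: "'a \<Rightarrow> 'o"
  Cod :: "'a \<Rightarrow> 'o"
  Id :: "'o \<Rightarrow> 'a"
  Comp :: "'a \<Rightarrow> 'a \<Rightarrow> 'a"

definition Hom :: "('o, 'a) cat \<Rightarrow> 'o \<Rightarrow> 'o \<Rightarrow> 'a set" where
  "Hom C x y = {f \<in> Arr C. Dom C f = x \<and> Cod C f = y}"

locale category =
  fixes C :: "('o, 'a) cat"
  assumes dom_in: "f \<in> Arr C \<Longrightarrow> Dom C f \<in> Obj C"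
    and cod_in: "f \<in> Arr C \<Longrightarrow> Cod C f \<in> Obj C"
    and id_in: "x \<in> Obj C \<Longrightarrow> Id C x \<in> Hom C x x"
    and comp_in: "\<lbrakk>f \<in> Hom C x y; g \<in> Hom C y z\<rbrakk> \<Longrightarrow> Comp C g f \<in> Hom C x z"
    and id_right: "f \<in> Hom C x y \<Longrightarrow> Comp C f (Id C x) = f"
    and id_left: "f \<in> Hom C x y \<Longrightarrow> Comp C (Id C y) f = f"
    and comp_assoc: "\<lbrakk>f \<in> Hom C w x; g \<in> Hom C x y; h \<in> Hom C y z\<rbrakk>
      \<Longrightarrow> Comp C h (Comp C g f) = Comp C (Comp C h g) f"

definition locally_small :: "'u rel \<Rightarrow> ('o, 'a) cat \<Rightarrow> bool" where
  "locally_small \<kappa> C \<longleftrightarrow> (\<forall>x \<in> Obj C. \<forall>y \<in> Obj C. small \<kappa> (Hom C x y))"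

definition small_category :: "'u rel \<Rightarrow> ('o, 'a) cat \<Rightarrow> bool" where
  "small_category \<kappa> C \<longleftrightarrow> category C \<and> small \<kappa> (Obj C) \<and> small \<kappa> (Arr C)"

definition op_cat :: "('o, 'a) cat \<Rightarrow> ('o, 'a) cat" where
  "op_cat C = \<lparr>Obj = Obj C, Arr = Arr C, Dom = Cod C, Cod = Dom C, Id = Id C,
     Comp = (\<lambda>g f. Comp C f g)\<rparr>"

definition full_subcategory :: "('o, 'a) cat \<Rightarrow> 'o set \<Rightarrow> ('o, 'a) cat" where
  "full_subcategory C S =
     \<lparr>Obj = S, Arr = {f \<in> Arr C. Dom C f \<in> S \<and> Cod C f \<in> S}, Dom = Dom C, Cod = Cod C,
      Id = Id C, Comp = Comp C\<rparr>"

record ('o1, 'a1, 'o2, 'a2) func =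
  OMap :: "'o1 \<Rightarrow> 'o2"
  AMap :: "'a1 \<Rightarrow> 'a2"

locale is_functor = dom: category A + cod: category B
  for A :: "('o1, 'a1) cat" and B :: "('o2, 'a2) cat" and F :: "('o1, 'a1, 'o2, 'a2) func" +
  assumes omap_in: "x \<in> Obj A \<Longrightarrow> OMap F x \<in> Obj B"
    and amap_in: "f \<in> Hom A x y \<Longrightarrow> AMap F f \<in> Hom B (OMap F x) (OMap F y)"
    and amap_id: "x \<in> Obj A \<Longrightarrow> AMap F (Id A x) = Id B (OMap F x)"
    and amap_comp: "\<lbrakk>f \<in> Hom A x y; g \<in> Hom A y z\<rbrakk>
      \<Longrightarrow> AMap F (Comp A g f) = Comp B (AMap F g) (AMap F f)"

definition comp_functor ::
  "('o2, 'a2, 'o3, 'a3) func \<Rightarrow> ('o1, 'a1, 'o2, 'a2) func \<Rightarrow> ('o1, 'a1, 'o3, 'a3) func"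
  (infixr "\<circ>\<^sub>F" 75) where
  "G \<circ>\<^sub>F F = \<lparr>OMap = OMap G \<circ> OMap F, AMap = AMap G \<circ> AMap F\<rparr>"

text \<open>
  The inclusion of a full subcategory acts as the identity on objects and arrows; its domain is
  recorded only where it is used as a functor.
\<close>

definition inclusion :: "('o, 'a, 'o, 'a) func" where
  "inclusion = \<lparr>OMap = id, AMap = id\<rparr>"

text \<open>
  The component functions are required to be \<open>extensional\<close> so that equality of functions is
  equality of natural transformations.
\<close>

locale nat_trans = source: is_functor A B F + target: is_functor A B G
  for A :: "('o1, 'a1) cat" and B :: "('o2, 'a2) cat"
    and F G :: "('o1, 'a1, 'o2, 'a2) func" and \<tau> :: "'o1 \<Rightarrow> 'a2" +
  assumes component_in: "x \<in> Obj A \<Longrightarrow> \<tau> x \<in> Hom B (OMap F x) (OMap G x)"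
    and naturality: "f \<in> Hom A x y
      \<Longrightarrow> Comp B (\<tau> y) (AMap F f) = Comp B (AMap G f) (\<tau> x)"
    and ext: "\<tau> \<in> extensional (Obj A)"

definition id_trans ::
  "('o1, 'a1) cat \<Rightarrow> ('o2, 'a2) cat \<Rightarrow> ('o1, 'a1, 'o2, 'a2) func \<Rightarrow> 'o1 \<Rightarrow> 'a2" where
  "id_trans A B F = (\<lambda>x \<in> Obj A. Id B (OMap F x))"


section \<open>Colimits and Kan extensions\<close>

definition is_cocone ::
  "('j, 'b) cat \<Rightarrow> ('o, 'a) cat \<Rightarrow> ('j, 'b, 'o, 'a) func \<Rightarrow> 'o \<Rightarrow> ('j \<Rightarrow> 'a) \<Rightarrow> bool" where
  "is_cocone J E \<Delta> X \<mu> \<longleftrightarrow>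
     is_functor J E \<Delta> \<and> X \<in> Obj E \<and>
     (\<forall>j \<in> Obj J. \<mu> j \<in> Hom E (OMap \<Delta> j) X) \<and>
     (\<forall>i j. \<forall>\<phi> \<in> Hom J i j. Comp E (\<mu> j) (AMap \<Delta> \<phi>) = \<mu> i)"

definition is_colimit ::
  "('j, 'b) cat \<Rightarrow> ('o, 'a) cat \<Rightarrow> ('j, 'b, 'o, 'a) func \<Rightarrow> 'o \<Rightarrow> ('j \<Rightarrow> 'a) \<Rightarrow> bool" where
  "is_colimit J E \<Delta> L \<mu> \<longleftrightarrow>
     is_cocone J E \<Delta> L \<mu> \<and>
     (\<forall>X \<nu>. is_cocone J E \<Delta> X \<nu> \<longrightarrow>
       (\<exists>!h. h \<in> Hom E L X \<and> (\<forall>j \<in> Obj J. Comp E h (\<mu> j) = \<nu> j)))"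

text \<open>
  \<open>F\<close>, with unit \<open>\<eta> : G \<Rightarrow> F \<circ> K\<close>, is the left Kan extension of \<open>G : B \<rightarrow> E\<close> along \<open>K : B \<rightarrow> C\<close>.
\<close>

definition is_left_kan_extension ::
  "('p, 'q) cat \<Rightarrow> ('o, 'a) cat \<Rightarrow> ('e, 'm) cat \<Rightarrow> ('p, 'q, 'o, 'a) func \<Rightarrow>
   ('p, 'q, 'e, 'm) func \<Rightarrow> ('o, 'a, 'e, 'm) func \<Rightarrow> ('p \<Rightarrow> 'm) \<Rightarrow> bool" where
  "is_left_kan_extension B C E K G F \<eta> \<longleftrightarrow>
     is_functor B C K \<and> nat_trans B E G (F \<circ>\<^sub>F K) \<eta> \<and> is_functor C E F \<and>
     (\<forall>H \<alpha>. is_functor C E H \<and> nat_trans B E G (H \<circ>\<^sub>F K) \<alpha> \<longrightarrow>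
       (\<exists>!\<sigma>. nat_trans C E F H \<sigma> \<and>
         (\<forall>b \<in> Obj B. Comp E (\<sigma> (OMap K b)) (\<eta> b) = \<alpha> b)))"


section \<open>The category of small sets and small functors\<close>

text \<open>
  Since the order \<open>\<kappa>\<close> is carried by \<open>'u\<close>, every small set of any type is in bijection with a small
  set of elements of \<open>'u\<close>.  An arrow is a triple of domain, extensional function and codomain.
\<close>

type_synonym 'u set_arr = "'u set \<times> ('u \<Rightarrow> 'u) \<times> 'u set"

definition SET :: "'u rel \<Rightarrow> ('u set, 'u set_arr) cat" where
  "SET \<kappa> =
     \<lparr>Obj = {A. small \<kappa> A},
      Arr = {(A, f, B). small \<kappa> A \<and> small \<kappa> B \<and> f \<in> A \<rightarrow>\<^sub>E B},
      Dom = (\<lambda>(A, f, B). A),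
      Cod = (\<lambda>(A, f, B). B),
      Id = (\<lambda>A. (A, (\<lambda>x \<in> A. x), A)),
      Comp = (\<lambda>(_, g, B') (A, f, _). (A, compose A g f, B'))\<rparr>"

text \<open>
  The hom-sets of \<open>C\<close> are sets of arrows of \<open>C\<close>, of a type unrelated to \<open>'u\<close>; \<open>code\<close> replaces each
  of them by a copy in \<open>'u\<close>.  It is injective on \<open>A\<close> whenever \<open>A\<close> is small.
\<close>

definition code :: "'a set \<Rightarrow> 'a \<Rightarrow> 'u" where
  "code A = (SOME e. inj_on e A)"

definition hom_set :: "('o, 'a) cat \<Rightarrow> 'o \<Rightarrow> 'o \<Rightarrow> 'u set" where
  "hom_set C x y = code (Hom C x y) ` Hom C x y"

text \<open>For \<open>f : x' \<rightarrow> x\<close> and \<open>g : y \<rightarrow> y'\<close>, the map \<open>h \<mapsto> g \<circ> h \<circ> f\<close> from \<open>Hom x y\<close> to \<open>Hom x' y'\<close>.\<close>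

definition hom_map :: "('o, 'a) cat \<Rightarrow> 'a \<Rightarrow> 'a \<Rightarrow> 'u set_arr" where
  "hom_map C f g =
    (let x = Cod C f; y = Dom C g; x' = Dom C f; y' = Cod C g in
     (hom_set C x y,
      (\<lambda>u \<in> hom_set C x y.
         code (Hom C x' y') (Comp C g (Comp C (inv_into (Hom C x y) (code (Hom C x y)) u) f))),
      hom_set C x' y'))"

text \<open>The functor \<open>Hom(x, -) : C \<rightarrow> SET\<close>.\<close>

definition representable :: "('o, 'a) cat \<Rightarrow> 'o \<Rightarrow> ('o, 'a, 'u set, 'u set_arr) func" where
  "representable C x = \<lparr>OMap = hom_set C x, AMap = hom_map C (Id C x)\<rparr>"

text \<open>For \<open>D : J \<rightarrow> C\<close>, the functor \<open>Hom(D -, c) : J\<^sup>o\<^sup>p \<rightarrow> SET\<close>.\<close>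

definition hom_diagram ::
  "('o, 'a) cat \<Rightarrow> ('j, 'b, 'o, 'a) func \<Rightarrow> 'o \<Rightarrow> ('j, 'b, 'u set, 'u set_arr) func" where
  "hom_diagram C D c =
     \<lparr>OMap = (\<lambda>j. hom_set C (OMap D j) c), AMap = (\<lambda>\<phi>. hom_map C (AMap D \<phi>) (Id C c))\<rparr>"

text \<open>
  \<open>F\<close> is a pointwise colimit of the diagram \<open>j \<mapsto> Hom(D j, -)\<close>, with colimit cocone \<open>\<mu>\<close>.  Up to
  isomorphism, every small category has its objects and arrows in \<open>'u\<close>.
\<close>

definition small_functor ::
  "'u rel \<Rightarrow> ('o, 'a) cat \<Rightarrow> ('o, 'a, 'u set, 'u set_arr) func \<Rightarrow> bool" where
  "small_functor \<kappa> C F \<longleftrightarrow>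
     is_functor C (SET \<kappa>) F \<and>
     (\<exists>(J :: ('u, 'u) cat) D \<mu>.
        small_category \<kappa> J \<and> is_functor J C D \<and>
        (\<forall>j \<in> Obj J. nat_trans C (SET \<kappa>) (representable C (OMap D j)) F (\<mu> j)) \<and>
        (\<forall>c \<in> Obj C. is_colimit (op_cat J) (SET \<kappa>) (hom_diagram C D c) (OMap F c) (\<lambda>j. \<mu> j c)))"

end

theory Submission
  imports Defs
begin

text \<open>
  Everything is compared with one notion: \<open>F\<close> is \<^emph>\<open>freely generated\<close> by a compatible family of
  elements \<open>e j \<in> F (D j)\<close>, indexed by a functor \<open>D : J \<rightarrow> C\<close>, if for every \<open>H\<close> the transformations
  \<open>F \<Rightarrow> H\<close> correspond, by evaluation at \<open>e\<close>, to the elements of the limit of \<open>H \<circ> D\<close>.  By the Yoneda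
  lemma this says that \<open>F\<close> is the colimit of the functors \<open>Hom(D j, -)\<close> in the category of
  set-valued functors on \<open>C\<close>; equally, that \<open>F\<close> is the left Kan extension along \<open>D\<close> of the functor
  with constant value a singleton.

  Smallness asks for a colimit at each object \<open>c\<close> separately.  A pointwise colimit is a colimit of
  functors, as always.  Conversely, evaluation at \<open>c\<close> has the right adjoint that sends a set \<open>X\<close> to
  the functor \<open>d \<mapsto> X\<^bsup>Hom(d, c)\<^esup>\<close>, so maps \<open>F c \<rightarrow> X\<close> are transformations from \<open>F\<close> into that functor,
  and the universal property of \<open>F\<close> among functors yields the one of \<open>F c\<close> among sets
  (\<open>freely_generated_imp_pointwise\<close>).  No colimit of sets has to be constructed; the argument uses
  that \<open>\<kappa>\<close> is a strong limit, so that these powers are small.  Hence \<open>F\<close> is small if and only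
  if it is freely generated over some small \<open>J\<close> (\<open>small_functor_iff_freely_generated\<close>).

  The four conditions are now linked in a cycle.
  \<^item> From (a) to (b), only the types of objects and arrows have to be changed
    (\<open>left_kan_extension_reindex\<close>).
  \<^item> From (b) to (c), every functor \<open>G\<close> on a small category is freely generated over its category of
    elements, which is again small because \<open>\<kappa>\<close> is regular (\<open>freely_generated_elements\<close>).
  \<^item> From (c) to (d), if \<open>G\<close> is freely generated along \<open>D\<close> and \<open>F\<close> is the left Kan extension of \<open>G\<close>
    along \<open>K\<close>, then \<open>F\<close> is freely generated along \<open>K \<circ> D\<close>: transformations \<open>F \<Rightarrow> H\<close> are
    transformations \<open>G \<Rightarrow> H \<circ> K\<close>, hence elements of the limit of \<open>H \<circ> K \<circ> D\<close>
    (\<open>freely_generated_left_kan_extension\<close>).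
  \<^item> From (d) to (a), take the full subcategory on the image of \<open>D\<close>; it is small because \<open>C\<close> is locally
    small.  The elements \<open>e j\<close> live over it and determine both transformations out of \<open>F\<close> and
    transformations out of its restriction (\<open>left_kan_extension_of_restriction\<close>).
\<close>

section \<open>Closure properties of the class of small sets\<close>

lemma small_inj:
  assumes "small \<kappa> B" and "inj_on f A" and "f ` A \<subseteq> B"
  shows "small \<kappa> A"
proof -
  have "|A| \<le>o |B|" using card_of_ordLeq[of A B] assms(2,3) by blast
  then show ?thesis using ordLeq_ordLess_trans assms(1) unfolding small_def by blast
qed

lemma small_subset: "\<lbrakk>small \<kappa> B; A \<subseteq> B\<rbrakk> \<Longrightarrow> small \<kappa> A"
  by (rule small_inj[where f = id]) auto

lemma small_image:
  assumes "small \<kappa> A"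
  shows "small \<kappa> (f ` A)"
  using ordLeq_ordLess_trans[OF card_of_image[of f A]] assms unfolding small_def by blast

lemma small_embeds:
  assumes "small \<kappa> A" and "\<kappa> \<le>o |UNIV :: 'x set|"
  shows "\<exists>f :: 'a \<Rightarrow> 'x. inj_on f A"
proof -
  have "|A| \<le>o |UNIV :: 'x set|"
    using assms ordLess_imp_ordLeq ordLess_ordLeq_trans unfolding small_def by blast
  then show ?thesis using card_of_ordLeq[of A "UNIV :: 'x set"] by blast
qed

lemma universe_le_UNIV:
  fixes \<kappa> :: "'u rel"
  assumes "universe_cardinal \<kappa>"
  shows "\<kappa> \<le>o |UNIV :: 'u set|"
proof -
  have "\<kappa> =o |Field \<kappa>|"
    using assms card_of_Field_ordIso ordIso_symmetric unfolding universe_cardinal_def by blast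
  then show ?thesis by (rule ordIso_ordLeq_trans) (rule card_of_mono1, simp)
qed

lemma inj_on_code:
  fixes \<kappa> :: "'u rel"
  assumes "universe_cardinal \<kappa>" and "small \<kappa> A"
  shows "inj_on (code A :: 'a \<Rightarrow> 'u) A"
  unfolding code_def
  using someI_ex[OF small_embeds[OF assms(2) universe_le_UNIV[OF assms(1)]]] by simp

lemma small_Sigma:
  assumes "universe_cardinal \<kappa>" and "small \<kappa> A" and "\<And>a. a \<in> A \<Longrightarrow> small \<kappa> (F a)"
  shows "small \<kappa> (Sigma A F)"
proof -
  have "stable \<kappa>"
    using assms(1) regularCard_stable unfolding universe_cardinal_def cinfinite_def by blast
  then show ?thesis using assms(2,3) stable_elim unfolding small_def by blast
qed

text \<open>
  The strong limit condition on \<open>\<kappa>\<close> speaks of sets of elements of \<open>'u\<close>; a coding transports it to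
  sets of any type.
\<close>

lemma small_Pow:
  fixes \<kappa> :: "'u rel"
  assumes "universe_cardinal \<kappa>" and "small \<kappa> A"
  shows "small \<kappa> (Pow A)"
proof -
  let ?c = "code A :: 'a \<Rightarrow> 'u"
  have inj: "inj_on ?c A" by (rule inj_on_code[OF assms])
  have "small \<kappa> (Pow (?c ` A))"
    using assms(1) small_image[OF assms(2)] unfolding universe_cardinal_def small_def by blast
  moreover have "inj_on ((`) ?c) (Pow A)" using inj by (rule inj_on_image_Pow)
  moreover have "(`) ?c ` Pow A \<subseteq> Pow (?c ` A)" by auto
  ultimately show ?thesis by (rule small_inj)
qed

text \<open>An extensional function is determined by its graph, a subset of the product.\<close>

lemma small_PiE:
  assumes "universe_cardinal \<kappa>" and "small \<kappa> A" and "small \<kappa> X"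
  shows "small \<kappa> (A \<rightarrow>\<^sub>E X)"
proof (rule small_inj)
  show "small \<kappa> (Pow (A \<times> X))" by (intro small_Pow small_Sigma assms)
  show "inj_on (\<lambda>f. (\<lambda>a. (a, f a)) ` A) (A \<rightarrow>\<^sub>E X)"
  proof (rule inj_onI)
    fix f g assume fg: "f \<in> A \<rightarrow>\<^sub>E X" "g \<in> A \<rightarrow>\<^sub>E X" and eq: "(\<lambda>a. (a, f a)) ` A = (\<lambda>a. (a, g a)) ` A"
    have "f a = g a" if "a \<in> A" for a using eq that by blast
    then show "f = g" using fg by (meson PiE_ext)
  qed
  show "(\<lambda>f. (\<lambda>a. (a, f a)) ` A) ` (A \<rightarrow>\<^sub>E X) \<subseteq> Pow (A \<times> X)" by auto
qed


section \<open>Elementwise description of set-valued functors and transformations\<close>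

lemma in_Hom: "f \<in> Hom C x y \<longleftrightarrow> f \<in> Arr C \<and> Dom C f = x \<and> Cod C f = y"
  by (simp add: Hom_def)

context category
begin

lemma Hom_Obj: "f \<in> Hom C x y \<Longrightarrow> x \<in> Obj C \<and> y \<in> Obj C"
  using dom_in cod_in by (auto simp: in_Hom)

end

text \<open>
  The underlying function of an arrow of \<open>SET\<close>, meaningful on its domain.  Identities between arrows
  and transformations are checked on elements through it.
\<close>

definition ap :: "'u set_arr \<Rightarrow> 'u \<Rightarrow> 'u" where
  "ap t = fst (snd t)"

lemma Obj_SET [simp]: "A \<in> Obj (SET \<kappa>) \<longleftrightarrow> small \<kappa> A"
  by (simp add: SET_def)

lemma in_Hom_SET:
  "t \<in> Hom (SET \<kappa>) A B \<longleftrightarrow> small \<kappa> A \<and> small \<kappa> B \<and> (\<exists>f \<in> A \<rightarrow>\<^sub>E B. t = (A, f, B))"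
  by (auto simp: in_Hom SET_def)

lemma Hom_SET_I:
  "\<lbrakk>small \<kappa> A; small \<kappa> B; \<And>x. x \<in> A \<Longrightarrow> f x \<in> B\<rbrakk> \<Longrightarrow> (A, (\<lambda>x \<in> A. f x), B) \<in> Hom (SET \<kappa>) A B"
  by (auto simp: in_Hom_SET)

lemma ap_restrict [simp]: "x \<in> A \<Longrightarrow> ap (A, (\<lambda>x \<in> A. f x), B) x = f x"
  by (simp add: ap_def)

lemma ap_in: "\<lbrakk>t \<in> Hom (SET \<kappa>) A B; x \<in> A\<rbrakk> \<Longrightarrow> ap t x \<in> B"
  by (auto simp: in_Hom_SET ap_def)

lemma SET_arr_eqI:
  assumes "s \<in> Hom (SET \<kappa>) A B" and "t \<in> Hom (SET \<kappa>) A B" and "\<And>x. x \<in> A \<Longrightarrow> ap s x = ap t x"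
  shows "s = t"
  using assms by (auto simp: in_Hom_SET ap_def) (metis PiE_ext)

lemma ap_Comp:
  "\<lbrakk>s \<in> Hom (SET \<kappa>) A B; t \<in> Hom (SET \<kappa>) B E; x \<in> A\<rbrakk>
    \<Longrightarrow> ap (Comp (SET \<kappa>) t s) x = ap t (ap s x)"
  unfolding in_Hom_SET by (auto simp: ap_def SET_def compose_def)

lemma ap_Id [simp]: "x \<in> A \<Longrightarrow> ap (Id (SET \<kappa>) A) x = x"
  by (simp add: SET_def)

lemma ex1_Hom_SET:
  assumes A: "small \<kappa> A" and B: "small \<kappa> B"
  shows "(\<exists>!m. m \<in> Hom (SET \<kappa>) A B \<and> P m) \<longleftrightarrow> (\<exists>!f. f \<in> A \<rightarrow>\<^sub>E B \<and> P (A, f, B))"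
proof
  assume l: "\<exists>!m. m \<in> Hom (SET \<kappa>) A B \<and> P m"
  then obtain f where f: "f \<in> A \<rightarrow>\<^sub>E B" "P (A, f, B)" by (auto simp: in_Hom_SET)
  have "g = f" if "g \<in> A \<rightarrow>\<^sub>E B" "P (A, g, B)" for g
  proof -
    have "(A, g, B) \<in> Hom (SET \<kappa>) A B" "(A, f, B) \<in> Hom (SET \<kappa>) A B"
      using A B f that by (simp_all add: in_Hom_SET)
    then have "(A, g, B) = (A, f, B)" using l f that by blast
    then show ?thesis by simp
  qed
  then show "\<exists>!f. f \<in> A \<rightarrow>\<^sub>E B \<and> P (A, f, B)" using f by blast
next
  assume r: "\<exists>!f. f \<in> A \<rightarrow>\<^sub>E B \<and> P (A, f, B)"
  then obtain f where f: "f \<in> A \<rightarrow>\<^sub>E B" "P (A, f, B)" by blast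
  show "\<exists>!m. m \<in> Hom (SET \<kappa>) A B \<and> P m"
  proof (rule ex1I)
    show "(A, f, B) \<in> Hom (SET \<kappa>) A B \<and> P (A, f, B)" using A B f by (simp add: in_Hom_SET)
    fix m assume m: "m \<in> Hom (SET \<kappa>) A B \<and> P m"
    then obtain g where "g \<in> A \<rightarrow>\<^sub>E B" "m = (A, g, B)" by (auto simp: in_Hom_SET)
    then show "m = (A, f, B)" using r f m by blast
  qed
qed

lemma category_SET: "category (SET \<kappa>)"
proof -
  have comp: "Comp (SET \<kappa>) t s \<in> Hom (SET \<kappa>) A E"
    if "s \<in> Hom (SET \<kappa>) A B" "t \<in> Hom (SET \<kappa>) B E" for s t A B E
    using that unfolding in_Hom_SET by (auto simp: SET_def compose_def PiE_iff)
  have ident: "Id (SET \<kappa>) A \<in> Hom (SET \<kappa>) A A" if "small \<kappa> A" for A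
    using that unfolding in_Hom_SET by (auto simp: SET_def)
  show ?thesis
  proof
    fix A B f assume f: "f \<in> Hom (SET \<kappa>) A B"
    then have s: "small \<kappa> A" "small \<kappa> B" by (auto simp: in_Hom_SET)
    show "Comp (SET \<kappa>) f (Id (SET \<kappa>) A) = f"
      by (rule SET_arr_eqI[OF comp[OF ident[OF s(1)] f] f])
        (simp add: ap_Comp[OF ident[OF s(1)] f])
    show "Comp (SET \<kappa>) (Id (SET \<kappa>) B) f = f"
      by (rule SET_arr_eqI[OF comp[OF f ident[OF s(2)]] f])
        (simp add: ap_Comp[OF f ident[OF s(2)]] ap_in[OF f])
  next
    fix A B E G f g h
    assume f: "f \<in> Hom (SET \<kappa>) A B" and g: "g \<in> Hom (SET \<kappa>) B E" and h: "h \<in> Hom (SET \<kappa>) E G"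
    show "Comp (SET \<kappa>) h (Comp (SET \<kappa>) g f) = Comp (SET \<kappa>) (Comp (SET \<kappa>) h g) f"
      by (rule SET_arr_eqI[OF comp[OF comp[OF f g] h] comp[OF f comp[OF g h]]])
        (simp add: ap_Comp[OF comp[OF f g] h] ap_Comp[OF f g] ap_Comp[OF f comp[OF g h]]
          ap_Comp[OF g h] ap_in[OF f])
  qed (use comp ident in \<open>auto simp: SET_def\<close>)
qed

lemma set_functorI:
  assumes "category C" and "\<And>x. x \<in> Obj C \<Longrightarrow> small \<kappa> (OMap F x)"
    and arr: "\<And>f x y. f \<in> Hom C x y \<Longrightarrow> AMap F f \<in> Hom (SET \<kappa>) (OMap F x) (OMap F y)"
    and ident: "\<And>x a. \<lbrakk>x \<in> Obj C; a \<in> OMap F x\<rbrakk> \<Longrightarrow> ap (AMap F (Id C x)) a = a"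
    and comp: "\<And>f g x y z a. \<lbrakk>f \<in> Hom C x y; g \<in> Hom C y z; a \<in> OMap F x\<rbrakk>
      \<Longrightarrow> ap (AMap F (Comp C g f)) a = ap (AMap F g) (ap (AMap F f) a)"
  shows "is_functor C (SET \<kappa>) F"
proof -
  interpret category C by fact
  interpret S: category "SET \<kappa>" by (rule category_SET)
  show ?thesis
  proof
    fix x assume x: "x \<in> Obj C"
    show "AMap F (Id C x) = Id (SET \<kappa>) (OMap F x)"
      by (rule SET_arr_eqI[OF arr[OF id_in[OF x]] S.id_in]) (simp_all add: assms x)
  next
    fix f g x y z assume f: "f \<in> Hom C x y" and g: "g \<in> Hom C y z"
    show "AMap F (Comp C g f) = Comp (SET \<kappa>) (AMap F g) (AMap F f)"
      by (rule SET_arr_eqI[OF arr[OF comp_in[OF f g]] S.comp_in[OF arr[OF f] arr[OF g]]])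
        (simp add: comp[OF f g] ap_Comp[OF arr[OF f] arr[OF g]])
  qed (simp_all add: assms)
qed

text \<open>
  The functor laws read as an action: an arrow \<open>f : x \<rightarrow> y\<close> moves \<open>a \<in> F x\<close> to
  \<open>ap (AMap F f) a \<in> F y\<close>.
\<close>

locale set_functor = is_functor C "SET \<kappa>" F
  for \<kappa> :: "'u rel" and C :: "('o, 'a) cat" and F :: "('o, 'a, 'u set, 'u set_arr) func"
begin

lemma small_value: "x \<in> Obj C \<Longrightarrow> small \<kappa> (OMap F x)"
  using omap_in by simp

lemma act_in: "\<lbrakk>f \<in> Hom C x y; a \<in> OMap F x\<rbrakk> \<Longrightarrow> ap (AMap F f) a \<in> OMap F y"
  by (rule ap_in[OF amap_in])

lemma act_id: "\<lbrakk>x \<in> Obj C; a \<in> OMap F x\<rbrakk> \<Longrightarrow> ap (AMap F (Id C x)) a = a"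
  by (simp add: amap_id)

lemma act_comp:
  "\<lbrakk>f \<in> Hom C x y; g \<in> Hom C y z; a \<in> OMap F x\<rbrakk>
    \<Longrightarrow> ap (AMap F (Comp C g f)) a = ap (AMap F g) (ap (AMap F f) a)"
  by (simp add: amap_comp ap_Comp[OF amap_in amap_in])

end

lemma set_functor_iff [simp]: "set_functor \<kappa> C F \<longleftrightarrow> is_functor C (SET \<kappa>) F"
  by (simp add: set_functor_def)

lemma nat_trans_ap_in:
  "\<lbrakk>nat_trans C (SET \<kappa>) F G \<tau>; x \<in> Obj C; a \<in> OMap F x\<rbrakk> \<Longrightarrow> ap (\<tau> x) a \<in> OMap G x"
  by (meson ap_in nat_trans.component_in)

lemma nat_trans_ap_natural:
  assumes "nat_trans C (SET \<kappa>) F G \<tau>" and "f \<in> Hom C x y" and "a \<in> OMap F x"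
  shows "ap (\<tau> y) (ap (AMap F f) a) = ap (AMap G f) (ap (\<tau> x) a)"
proof -
  interpret nat_trans C "SET \<kappa>" F G \<tau> by fact
  have xy: "x \<in> Obj C" "y \<in> Obj C" using source.dom.Hom_Obj assms(2) by blast+
  show ?thesis
    using naturality[OF assms(2)] ap_Comp[OF source.amap_in[OF assms(2)] component_in[OF xy(2)]]
      ap_Comp[OF component_in[OF xy(1)] target.amap_in[OF assms(2)]] assms(3) by metis
qed

lemma set_nat_transI:
  assumes F: "is_functor C (SET \<kappa>) F" and G: "is_functor C (SET \<kappa>) G"
    and comp: "\<And>x. x \<in> Obj C \<Longrightarrow> \<tau> x \<in> Hom (SET \<kappa>) (OMap F x) (OMap G x)"
    and nat: "\<And>f x y a. \<lbrakk>f \<in> Hom C x y; a \<in> OMap F x\<rbrakk>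
      \<Longrightarrow> ap (\<tau> y) (ap (AMap F f) a) = ap (AMap G f) (ap (\<tau> x) a)"
    and "\<tau> \<in> extensional (Obj C)"
  shows "nat_trans C (SET \<kappa>) F G \<tau>"
proof -
  interpret F: is_functor C "SET \<kappa>" F by fact
  interpret G: is_functor C "SET \<kappa>" G by fact
  show ?thesis
  proof
    fix f x y assume f: "f \<in> Hom C x y"
    then have xy: "x \<in> Obj C" "y \<in> Obj C" using F.dom.Hom_Obj by blast+
    show "Comp (SET \<kappa>) (\<tau> y) (AMap F f) = Comp (SET \<kappa>) (AMap G f) (\<tau> x)"
      by (rule SET_arr_eqI[OF F.cod.comp_in[OF F.amap_in[OF f] comp[OF xy(2)]]
            F.cod.comp_in[OF comp[OF xy(1)] G.amap_in[OF f]]])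
        (simp add: ap_Comp[OF F.amap_in[OF f] comp[OF xy(2)]]
          ap_Comp[OF comp[OF xy(1)] G.amap_in[OF f]] nat[OF f])
  qed (simp_all add: assms)
qed

definition set_trans :: "('o, 'a) cat \<Rightarrow> ('o, 'a, 'u set, 'u set_arr) func \<Rightarrow>
    ('o, 'a, 'u set, 'u set_arr) func \<Rightarrow> ('o \<Rightarrow> 'u \<Rightarrow> 'u) \<Rightarrow> 'o \<Rightarrow> 'u set_arr" where
  "set_trans C F G t = (\<lambda>x \<in> Obj C. (OMap F x, (\<lambda>a \<in> OMap F x. t x a), OMap G x))"

lemma ap_set_trans [simp]: "\<lbrakk>x \<in> Obj C; a \<in> OMap F x\<rbrakk> \<Longrightarrow> ap (set_trans C F G t x) a = t x a"
  by (simp add: set_trans_def)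

lemma nat_trans_set_trans:
  assumes F: "is_functor C (SET \<kappa>) F" and G: "is_functor C (SET \<kappa>) G"
    and comp: "\<And>x a. \<lbrakk>x \<in> Obj C; a \<in> OMap F x\<rbrakk> \<Longrightarrow> t x a \<in> OMap G x"
    and nat: "\<And>f x y a. \<lbrakk>f \<in> Hom C x y; a \<in> OMap F x\<rbrakk>
      \<Longrightarrow> t y (ap (AMap F f) a) = ap (AMap G f) (t x a)"
  shows "nat_trans C (SET \<kappa>) F G (set_trans C F G t)"
proof -
  interpret F: set_functor \<kappa> C F using F by simp
  interpret G: set_functor \<kappa> C G using G by simp
  show ?thesis
  proof (rule set_nat_transI[OF F G])
    fix x assume "x \<in> Obj C"
    then show "set_trans C F G t x \<in> Hom (SET \<kappa>) (OMap F x) (OMap G x)"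
      using Hom_SET_I[OF F.small_value G.small_value] comp by (simp add: set_trans_def)
  next
    fix f x y a assume f: "f \<in> Hom C x y" and a: "a \<in> OMap F x"
    then show "ap (set_trans C F G t y) (ap (AMap F f) a) = ap (AMap G f) (ap (set_trans C F G t x) a)"
      using F.dom.Hom_Obj[OF f] F.act_in[OF f a] nat[OF f a] by simp
  qed (simp add: set_trans_def)
qed

lemma nat_trans_eqI:
  assumes "nat_trans C (SET \<kappa>) F G \<sigma>" and "nat_trans C (SET \<kappa>) F G \<tau>"
    and "\<And>x a. \<lbrakk>x \<in> Obj C; a \<in> OMap F x\<rbrakk> \<Longrightarrow> ap (\<sigma> x) a = ap (\<tau> x) a"
  shows "\<sigma> = \<tau>"
proof (rule extensionalityI)
  show "\<sigma> \<in> extensional (Obj C)" "\<tau> \<in> extensional (Obj C)"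
    using assms(1,2) nat_trans.ext by blast+
  show "\<sigma> x = \<tau> x" if "x \<in> Obj C" for x
    using assms nat_trans.component_in SET_arr_eqI that by metis
qed

lemma is_functor_comp:
  assumes "is_functor A B F" and "is_functor B C G"
  shows "is_functor A C (G \<circ>\<^sub>F F)"
proof -
  interpret F: is_functor A B F by fact
  interpret G: is_functor B C G by fact
  show ?thesis
    by unfold_locales
      (auto simp: comp_functor_def F.omap_in G.omap_in F.amap_id G.amap_id
        F.amap_comp G.amap_comp[OF F.amap_in F.amap_in] intro!: G.amap_in F.amap_in)
qed

lemma comp_functor_simps [simp]:
  "OMap (G \<circ>\<^sub>F F) x = OMap G (OMap F x)" "AMap (G \<circ>\<^sub>F F) f = AMap G (AMap F f)"
  by (simp_all add: comp_functor_def)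

lemma comp_functor_assoc: "(H \<circ>\<^sub>F G) \<circ>\<^sub>F F = H \<circ>\<^sub>F (G \<circ>\<^sub>F F)"
  by (simp add: comp_functor_def o_assoc)


section \<open>Free generation of a functor by compatible elements\<close>

text \<open>
  An element of the limit of \<open>T\<close>, as a compatible family.  Only the values of the family on objects of
  \<open>J\<close> matter.
\<close>

definition limit_element ::
  "('j, 'b) cat \<Rightarrow> ('j, 'b, 'u set, 'u set_arr) func \<Rightarrow> ('j \<Rightarrow> 'u) \<Rightarrow> bool" where
  "limit_element J T a \<longleftrightarrow>
     (\<forall>j \<in> Obj J. a j \<in> OMap T j) \<and> (\<forall>i j. \<forall>\<phi> \<in> Hom J i j. ap (AMap T \<phi>) (a i) = a j)"

text \<open>
  The bijection \<open>Nat(F, H) \<cong> lim (H \<circ> D)\<close> given by evaluation at \<open>e\<close>.  Here \<open>e j\<close> is the element that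
  corresponds by Yoneda to the coprojection \<open>Hom(D j, -) \<Rightarrow> F\<close>.
\<close>

definition freely_generated :: "'u rel \<Rightarrow> ('j, 'b) cat \<Rightarrow> ('o, 'a) cat \<Rightarrow> ('j, 'b, 'o, 'a) func \<Rightarrow>
    ('o, 'a, 'u set, 'u set_arr) func \<Rightarrow> ('j \<Rightarrow> 'u) \<Rightarrow> bool" where
  "freely_generated \<kappa> J C D F e \<longleftrightarrow>
     is_functor J C D \<and> is_functor C (SET \<kappa>) F \<and> limit_element J (F \<circ>\<^sub>F D) e \<and>
     (\<forall>H a. is_functor C (SET \<kappa>) H \<and> limit_element J (H \<circ>\<^sub>F D) a \<longrightarrow>
       (\<exists>!\<sigma>. nat_trans C (SET \<kappa>) F H \<sigma> \<and> (\<forall>j \<in> Obj J. ap (\<sigma> (OMap D j)) (e j) = a j)))"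

text \<open>
  A cocone to \<open>X\<close> on the diagram \<open>Hom(D -, c) : J\<^sup>o\<^sup>p \<rightarrow> Set\<close>.  It is stated on arrows of \<open>C\<close>
  themselves rather than on their codes, which keeps the coding out of the arguments below.
\<close>

definition hom_cocone :: "('j, 'b) cat \<Rightarrow> ('o, 'a) cat \<Rightarrow> ('j, 'b, 'o, 'a) func \<Rightarrow> 'o \<Rightarrow>
    'u set \<Rightarrow> ('j \<Rightarrow> 'a \<Rightarrow> 'u) \<Rightarrow> bool" where
  "hom_cocone J C D c X \<nu> \<longleftrightarrow>
     (\<forall>j \<in> Obj J. \<forall>k \<in> Hom C (OMap D j) c. \<nu> j k \<in> X) \<and>
     (\<forall>i j. \<forall>\<phi> \<in> Hom J i j. \<forall>k \<in> Hom C (OMap D j) c. \<nu> i (Comp C k (AMap D \<phi>)) = \<nu> j k)"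

definition universal_hom_cocone :: "'u rel \<Rightarrow> ('j, 'b) cat \<Rightarrow> ('o, 'a) cat \<Rightarrow>
    ('j, 'b, 'o, 'a) func \<Rightarrow> 'o \<Rightarrow> 'u set \<Rightarrow> ('j \<Rightarrow> 'a \<Rightarrow> 'u) \<Rightarrow> bool" where
  "universal_hom_cocone \<kappa> J C D c L \<mu> \<longleftrightarrow>
     hom_cocone J C D c L \<mu> \<and>
     (\<forall>(X :: 'u set) \<nu>. small \<kappa> X \<and> hom_cocone J C D c X \<nu> \<longrightarrow>
       (\<exists>!h. h \<in> L \<rightarrow>\<^sub>E X \<and> (\<forall>j \<in> Obj J. \<forall>k \<in> Hom C (OMap D j) c. h (\<mu> j k) = \<nu> j k)))"

lemma limit_elementD:
  assumes "limit_element J T a"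
  shows "j \<in> Obj J \<Longrightarrow> a j \<in> OMap T j" and "\<phi> \<in> Hom J i j \<Longrightarrow> ap (AMap T \<phi>) (a i) = a j"
  using assms by (auto simp: limit_element_def)

lemma hom_coconeD:
  assumes "hom_cocone J C D c X \<nu>"
  shows "\<lbrakk>j \<in> Obj J; k \<in> Hom C (OMap D j) c\<rbrakk> \<Longrightarrow> \<nu> j k \<in> X"
    and "\<lbrakk>\<phi> \<in> Hom J i j; k \<in> Hom C (OMap D j) c\<rbrakk> \<Longrightarrow> \<nu> i (Comp C k (AMap D \<phi>)) = \<nu> j k"
  using assms unfolding hom_cocone_def by blast+

text \<open>
  The elements \<open>\<mu> j k\<close> separate maps out of \<open>L\<close>: this is how functions on the values of a pointwise
  colimit are shown to be equal.
\<close>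

lemma universal_hom_cocone_unique:
  fixes X L :: "'u set"
  assumes U: "universal_hom_cocone \<kappa> J C D c L \<mu>" and "small \<kappa> X" and "hom_cocone J C D c X \<nu>"
    and "\<And>x. x \<in> L \<Longrightarrow> g x \<in> X" and "\<And>x. x \<in> L \<Longrightarrow> h x \<in> X"
    and "\<And>j k. \<lbrakk>j \<in> Obj J; k \<in> Hom C (OMap D j) c\<rbrakk> \<Longrightarrow> g (\<mu> j k) = \<nu> j k"
    and "\<And>j k. \<lbrakk>j \<in> Obj J; k \<in> Hom C (OMap D j) c\<rbrakk> \<Longrightarrow> h (\<mu> j k) = \<nu> j k"
    and x: "x \<in> L"
  shows "g x = h x"
proof -
  let ?P = "\<lambda>h. h \<in> L \<rightarrow>\<^sub>E X \<and> (\<forall>j \<in> Obj J. \<forall>k \<in> Hom C (OMap D j) c. h (\<mu> j k) = \<nu> j k)"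
  have "\<mu> j k \<in> L" if "j \<in> Obj J" "k \<in> Hom C (OMap D j) c" for j k
    using U that unfolding universal_hom_cocone_def hom_cocone_def by blast
  then have "?P (restrict g L)" "?P (restrict h L)" using assms by auto
  moreover have "\<exists>!h. ?P h" using U assms(2,3) unfolding universal_hom_cocone_def by blast
  ultimately have "restrict g L = restrict h L" by blast
  then show ?thesis using x by (metis restrict_apply')
qed

lemma hom_cocone_act:
  assumes D: "is_functor J C D" and H: "is_functor C (SET \<kappa>) H" and a: "limit_element J (H \<circ>\<^sub>F D) a"
  shows "hom_cocone J C D c (OMap H c) (\<lambda>j k. ap (AMap H k) (a j))"
proof -
  interpret D: is_functor J C D by fact
  interpret H: set_functor \<kappa> C H using H by simp
  show ?thesis
    unfolding hom_cocone_def
  proof (intro conjI ballI allI)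
    fix j k assume "j \<in> Obj J" "k \<in> Hom C (OMap D j) c"
    then show "ap (AMap H k) (a j) \<in> OMap H c" using H.act_in limit_elementD(1)[OF a] by simp
  next
    fix i j \<phi> k assume \<phi>: "\<phi> \<in> Hom J i j" and k: "k \<in> Hom C (OMap D j) c"
    have "a i \<in> OMap H (OMap D i)" using limit_elementD(1)[OF a] D.dom.Hom_Obj[OF \<phi>] by simp
    then show "ap (AMap H (Comp C k (AMap D \<phi>))) (a i) = ap (AMap H k) (a j)"
      using H.act_comp[OF D.amap_in[OF \<phi>] k] limit_elementD(2)[OF a \<phi>] by simp
  qed
qed

lemma hom_cocone_postcompose:
  assumes D: "is_functor J C D" and f: "f \<in> Hom C c d" and \<nu>: "hom_cocone J C D d X \<nu>"
  shows "hom_cocone J C D c X (\<lambda>j k. \<nu> j (Comp C f k))"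
proof -
  interpret D: is_functor J C D by fact
  show ?thesis
    unfolding hom_cocone_def
  proof (intro conjI ballI allI)
    fix j k assume "j \<in> Obj J" "k \<in> Hom C (OMap D j) c"
    then show "\<nu> j (Comp C f k) \<in> X" using hom_coconeD(1)[OF \<nu>] D.cod.comp_in f by blast
  next
    fix i j \<phi> k assume \<phi>: "\<phi> \<in> Hom J i j" and k: "k \<in> Hom C (OMap D j) c"
    show "\<nu> i (Comp C f (Comp C k (AMap D \<phi>))) = \<nu> j (Comp C f k)"
      using hom_coconeD(2)[OF \<nu> \<phi> D.cod.comp_in[OF k f]] D.cod.comp_assoc[OF D.amap_in[OF \<phi>] k f]
      by simp
  qed
qed

text \<open>
  Colimits computed objectwise are colimits of functors: the components of the induced
  transformation are given by the universal property at each object, and its naturality square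
  commutes because both composites are induced by the same cocone.
\<close>

lemma pointwise_imp_freely_generated:
  assumes D: "is_functor J C D" and F: "is_functor C (SET \<kappa>) F" and e: "limit_element J (F \<circ>\<^sub>F D) e"
    and U: "\<And>c. c \<in> Obj C
      \<Longrightarrow> universal_hom_cocone \<kappa> J C D c (OMap F c) (\<lambda>j k. ap (AMap F k) (e j))"
  shows "freely_generated \<kappa> J C D F e"
proof -
  interpret D: is_functor J C D by fact
  interpret F: set_functor \<kappa> C F using F by simp
  have "\<exists>!\<sigma>. nat_trans C (SET \<kappa>) F H \<sigma> \<and> (\<forall>j \<in> Obj J. ap (\<sigma> (OMap D j)) (e j) = a j)"
    if H: "is_functor C (SET \<kappa>) H" and a: "limit_element J (H \<circ>\<^sub>F D) a" for H a
  proof -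
    interpret H: set_functor \<kappa> C H using H by simp
    have coc: "hom_cocone J C D c (OMap H c) (\<lambda>j k. ap (AMap H k) (a j))" for c
      using hom_cocone_act[OF D H a] .
    have "\<forall>c \<in> Obj C. \<exists>h. h \<in> OMap F c \<rightarrow>\<^sub>E OMap H c \<and>
        (\<forall>j \<in> Obj J. \<forall>k \<in> Hom C (OMap D j) c. h (ap (AMap F k) (e j)) = ap (AMap H k) (a j))"
      using U H.small_value coc unfolding universal_hom_cocone_def by blast
    then obtain h where h: "\<And>c. c \<in> Obj C \<Longrightarrow> h c \<in> OMap F c \<rightarrow>\<^sub>E OMap H c"
        "\<And>c j k. \<lbrakk>c \<in> Obj C; j \<in> Obj J; k \<in> Hom C (OMap D j) c\<rbrakk>
          \<Longrightarrow> h c (ap (AMap F k) (e j)) = ap (AMap H k) (a j)"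
      by metis
    have h_in: "h c x \<in> OMap H c" if "c \<in> Obj C" "x \<in> OMap F c" for c x using h(1) that by blast
    let ?\<sigma> = "set_trans C F H h"
    have nat: "h d (ap (AMap F f) x) = ap (AMap H f) (h c x)"
      if f: "f \<in> Hom C c d" and x: "x \<in> OMap F c" for f c d x
    proof -
      have cd: "c \<in> Obj C" "d \<in> Obj C" using D.cod.Hom_Obj[OF f] by auto
      show ?thesis
      proof (rule universal_hom_cocone_unique[OF U[OF cd(1)] H.small_value[OF cd(2)]
            hom_cocone_postcompose[OF D f coc] _ _ _ _ x, where g = "\<lambda>x. h d (ap (AMap F f) x)"])
        fix j k assume j: "j \<in> Obj J" and k: "k \<in> Hom C (OMap D j) c"
        have ej: "e j \<in> OMap F (OMap D j)" "a j \<in> OMap H (OMap D j)"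
          using limit_elementD(1)[OF e j] limit_elementD(1)[OF a j] by simp_all
        show "h d (ap (AMap F f) (ap (AMap F k) (e j))) = ap (AMap H (Comp C f k)) (a j)"
          using h(2)[OF cd(2) j D.cod.comp_in[OF k f]] F.act_comp[OF k f ej(1)] by simp
        show "ap (AMap H f) (h c (ap (AMap F k) (e j))) = ap (AMap H (Comp C f k)) (a j)"
          using h(2)[OF cd(1) j k] H.act_comp[OF k f ej(2)] by simp
      qed (use h_in cd F.act_in[OF f] H.act_in[OF f] in blast)+
    qed
    have \<sigma>: "nat_trans C (SET \<kappa>) F H ?\<sigma>"
      by (rule nat_trans_set_trans[OF F H]) (simp_all add: h_in nat)
    have \<sigma>e: "ap (?\<sigma> (OMap D j)) (e j) = a j" if j: "j \<in> Obj J" for j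
    proof -
      have "e j \<in> OMap F (OMap D j)" "a j \<in> OMap H (OMap D j)"
        using limit_elementD(1)[OF e j] limit_elementD(1)[OF a j] by simp_all
      then show ?thesis
        using h(2)[OF _ j D.cod.id_in] D.omap_in[OF j] F.act_id H.act_id by simp
    qed
    show ?thesis
    proof (rule ex1I[of _ ?\<sigma>])
      show "nat_trans C (SET \<kappa>) F H ?\<sigma> \<and> (\<forall>j \<in> Obj J. ap (?\<sigma> (OMap D j)) (e j) = a j)"
        using \<sigma> \<sigma>e by blast
    next
      fix \<tau> assume \<tau>: "nat_trans C (SET \<kappa>) F H \<tau> \<and> (\<forall>j \<in> Obj J. ap (\<tau> (OMap D j)) (e j) = a j)"
      then have \<tau>n: "nat_trans C (SET \<kappa>) F H \<tau>" by blast
      show "\<tau> = ?\<sigma>"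
      proof (rule nat_trans_eqI[OF \<tau>n \<sigma>])
        fix c x assume c: "c \<in> Obj C" and x: "x \<in> OMap F c"
        show "ap (\<tau> c) x = ap (?\<sigma> c) x"
        proof (rule universal_hom_cocone_unique[OF U[OF c] H.small_value[OF c] coc _ _ _ _ x])
          fix j k assume j: "j \<in> Obj J" and k: "k \<in> Hom C (OMap D j) c"
          have ej: "e j \<in> OMap F (OMap D j)" using limit_elementD(1)[OF e j] by simp
          show "ap (\<tau> c) (ap (AMap F k) (e j)) = ap (AMap H k) (a j)"
            using nat_trans_ap_natural[OF \<tau>n k ej] \<tau> j by simp
          show "ap (?\<sigma> c) (ap (AMap F k) (e j)) = ap (AMap H k) (a j)"
            using nat_trans_ap_natural[OF \<sigma> k ej] \<sigma>e j by simp
        qed (use nat_trans_ap_in[OF \<tau>n c] nat_trans_ap_in[OF \<sigma> c] in blast)+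
      qed
    qed
  qed
  then show ?thesis using D F e unfolding freely_generated_def by blast
qed


section \<open>Powers of a set by the contravariant hom functors\<close>

locale locally_small_category = category C for C :: "('o, 'a) cat" +
  fixes \<kappa> :: "'u rel"
  assumes universe: "universe_cardinal \<kappa>" and locally_small: "locally_small \<kappa> C"
begin

lemma small_Hom: "small \<kappa> (Hom C x y)"
proof (cases "x \<in> Obj C \<and> y \<in> Obj C")
  case True
  then show ?thesis using locally_small by (simp add: locally_small_def)
next
  case False
  then have "Hom C x y = {}" using Hom_Obj by blast
  moreover have "small \<kappa> ({} :: 'a set)"
    using universe unfolding small_def universe_cardinal_def cinfinite_def
    by (metis Field_card_of card_of_Well_order card_order_on_well_order_on finite.emptyI
        finite_ordLess_infinite)
  ultimately show ?thesis by simp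
qed

end

text \<open>
  The functor \<open>d \<mapsto> X\<^bsup>Hom(d, c)\<^esup>\<close>, where \<open>f : d \<rightarrow> d'\<close> sends \<open>\<phi>\<close> to \<open>l \<mapsto> \<phi> (l \<circ> f)\<close>.  The functions are
  coded by elements of \<open>'u\<close>, as the values must be objects of \<open>SET\<close>.
\<close>

definition power_functor :: "('o, 'a) cat \<Rightarrow> 'o \<Rightarrow> 'u set \<Rightarrow> ('o, 'a, 'u set, 'u set_arr) func" where
  "power_functor C c X =
    (let E = (\<lambda>d. Hom C d c \<rightarrow>\<^sub>E X); P = (\<lambda>d. code (E d) ` E d) in
     \<lparr>OMap = P,
      AMap = (\<lambda>f. (P (Dom C f),
        (\<lambda>u \<in> P (Dom C f). code (E (Cod C f))
           (\<lambda>l \<in> Hom C (Cod C f) c. inv_into (E (Dom C f)) (code (E (Dom C f))) u (Comp C l f))),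
        P (Cod C f)))\<rparr>)"

context locally_small_category
begin

definition power_code :: "'o \<Rightarrow> 'u set \<Rightarrow> 'o \<Rightarrow> ('a \<Rightarrow> 'u) \<Rightarrow> 'u" where
  "power_code c X d = code (Hom C d c \<rightarrow>\<^sub>E X)"

lemma inj_power_code: "small \<kappa> X \<Longrightarrow> inj_on (power_code c X d) (Hom C d c \<rightarrow>\<^sub>E X)"
  unfolding power_code_def using inj_on_code[OF universe small_PiE[OF universe small_Hom]] by blast

lemma OMap_power_functor: "OMap (power_functor C c X) d = power_code c X d ` (Hom C d c \<rightarrow>\<^sub>E X)"
  by (simp add: power_functor_def power_code_def)

lemma AMap_power_functor:
  assumes X: "small \<kappa> X" and f: "f \<in> Hom C d d'"
  shows "AMap (power_functor C c X) f \<in> Hom (SET \<kappa>) (OMap (power_functor C c X) d)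
      (OMap (power_functor C c X) d')"
    and "\<phi> \<in> Hom C d c \<rightarrow>\<^sub>E X \<Longrightarrow> ap (AMap (power_functor C c X) f) (power_code c X d \<phi>) =
      power_code c X d' (\<lambda>l \<in> Hom C d' c. \<phi> (Comp C l f))"
proof -
  have d: "Dom C f = d" "Cod C f = d'" using f by (auto simp: in_Hom)
  let ?P = "OMap (power_functor C c X)"
  let ?i = "inv_into (Hom C d c \<rightarrow>\<^sub>E X) (power_code c X d)"
  have eq: "AMap (power_functor C c X) f =
      (?P d, (\<lambda>u \<in> ?P d. power_code c X d' (\<lambda>l \<in> Hom C d' c. ?i u (Comp C l f))), ?P d')"
    by (simp add: power_functor_def power_code_def Let_def d)
  have inv: "?i (power_code c X d \<phi>) = \<phi>" if "\<phi> \<in> Hom C d c \<rightarrow>\<^sub>E X" for \<phi>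
    using inv_into_f_f[OF inj_power_code[OF X]] that .
  have sm: "small \<kappa> (?P d)" for d
    unfolding OMap_power_functor by (intro small_image small_PiE universe small_Hom X)
  have res: "(\<lambda>l \<in> Hom C d' c. \<phi> (Comp C l f)) \<in> Hom C d' c \<rightarrow>\<^sub>E X"
    if "\<phi> \<in> Hom C d c \<rightarrow>\<^sub>E X" for \<phi>
    using that comp_in[OF f] by auto
  show "AMap (power_functor C c X) f \<in> Hom (SET \<kappa>) (?P d) (?P d')"
    unfolding eq by (rule Hom_SET_I[OF sm sm]) (use inv res in \<open>auto simp: OMap_power_functor\<close>)
  show "ap (AMap (power_functor C c X) f) (power_code c X d \<phi>) =
      power_code c X d' (\<lambda>l \<in> Hom C d' c. \<phi> (Comp C l f))" if "\<phi> \<in> Hom C d c \<rightarrow>\<^sub>E X"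
    unfolding eq using that inv by (simp add: OMap_power_functor)
qed

lemma is_functor_power_functor:
  assumes X: "small \<kappa> X"
  shows "is_functor C (SET \<kappa>) (power_functor C c X)"
proof (rule set_functorI)
  show "category C" by unfold_locales
  show "small \<kappa> (OMap (power_functor C c X) x)" for x
    unfolding OMap_power_functor by (intro small_image small_PiE universe small_Hom X)
  show "AMap (power_functor C c X) f \<in> Hom (SET \<kappa>) (OMap (power_functor C c X) x)
      (OMap (power_functor C c X) y)" if "f \<in> Hom C x y" for f x y
    using AMap_power_functor(1)[OF X that] .
  fix x a assume x: "x \<in> Obj C" and "a \<in> OMap (power_functor C c X) x"
  then obtain \<phi> where \<phi>: "\<phi> \<in> Hom C x c \<rightarrow>\<^sub>E X" and a: "a = power_code c X x \<phi>"
    by (auto simp: OMap_power_functor)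
  have "(\<lambda>l \<in> Hom C x c. \<phi> (Comp C l (Id C x))) = \<phi>"
    using \<phi> id_right by (auto simp: fun_eq_iff PiE_def extensional_def)
  then show "ap (AMap (power_functor C c X) (Id C x)) a = a"
    using AMap_power_functor(2)[OF X id_in[OF x] \<phi>] a by simp
next
  fix f g x y z a assume f: "f \<in> Hom C x y" and g: "g \<in> Hom C y z"
    and "a \<in> OMap (power_functor C c X) x"
  then obtain \<phi> where \<phi>: "\<phi> \<in> Hom C x c \<rightarrow>\<^sub>E X" and a: "a = power_code c X x \<phi>"
    by (auto simp: OMap_power_functor)
  have \<phi>': "(\<lambda>l \<in> Hom C y c. \<phi> (Comp C l f)) \<in> Hom C y c \<rightarrow>\<^sub>E X"
    using \<phi> comp_in[OF f] by auto
  have "(\<lambda>l \<in> Hom C z c. \<phi> (Comp C l (Comp C g f))) =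
      (\<lambda>l \<in> Hom C z c. (\<lambda>l \<in> Hom C y c. \<phi> (Comp C l f)) (Comp C l g))"
    using comp_assoc[OF f g] comp_in[OF g] by (auto simp: fun_eq_iff)
  then show "ap (AMap (power_functor C c X) (Comp C g f)) a =
      ap (AMap (power_functor C c X) g) (ap (AMap (power_functor C c X) f) a)"
    using AMap_power_functor(2)[OF X comp_in[OF f g] \<phi>] AMap_power_functor(2)[OF X f \<phi>]
      AMap_power_functor(2)[OF X g \<phi>'] a by simp
qed

text \<open>
  One half of the adjunction between evaluation at \<open>c\<close> and the power functor: the transpose of
  \<open>h : F c \<rightarrow> X\<close> sends \<open>x \<in> F d\<close> to the function \<open>k \<mapsto> h (F k x)\<close> on \<open>Hom(d, c)\<close>.  From the transpose, \<open>h\<close> is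
  recovered by evaluation at the identity of \<open>c\<close>.
\<close>

lemma nat_trans_to_power:
  assumes X: "small \<kappa> X" and F: "is_functor C (SET \<kappa>) F" and h: "\<And>x. x \<in> OMap F c \<Longrightarrow> h x \<in> X"
  shows "nat_trans C (SET \<kappa>) F (power_functor C c X) (set_trans C F (power_functor C c X)
    (\<lambda>d x. power_code c X d (\<lambda>k \<in> Hom C d c. h (ap (AMap F k) x))))"
proof (rule nat_trans_set_trans[OF F is_functor_power_functor[OF X]])
  interpret F: set_functor \<kappa> C F using F by simp
  have in_E: "(\<lambda>k \<in> Hom C d c. h (ap (AMap F k) x)) \<in> Hom C d c \<rightarrow>\<^sub>E X" if "x \<in> OMap F d" for d x
    using F.act_in that h by auto
  then show "power_code c X d (\<lambda>k \<in> Hom C d c. h (ap (AMap F k) x)) \<in> OMap (power_functor C c X) d"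
    if "x \<in> OMap F d" for d x
    using that by (simp add: OMap_power_functor)
  fix f d d' x assume f: "f \<in> Hom C d d'" and x: "x \<in> OMap F d"
  have "(\<lambda>k \<in> Hom C d' c. h (ap (AMap F k) (ap (AMap F f) x))) =
      (\<lambda>l \<in> Hom C d' c. (\<lambda>k \<in> Hom C d c. h (ap (AMap F k) x)) (Comp C l f))"
    using F.act_comp[OF f _ x] comp_in[OF f] by (auto simp: fun_eq_iff)
  then show "power_code c X d' (\<lambda>k \<in> Hom C d' c. h (ap (AMap F k) (ap (AMap F f) x))) =
      ap (AMap (power_functor C c X) f) (power_code c X d (\<lambda>k \<in> Hom C d c. h (ap (AMap F k) x)))"
    using AMap_power_functor(2)[OF X f in_E[OF x]] by simp
qed

text \<open>
  Evaluation at \<open>c\<close> preserves the colimit because it is a left adjoint.  A cocone \<open>\<nu>\<close> with vertex \<open>X\<close>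
  over \<open>c\<close> is the same thing as a compatible family \<open>a j = \<nu> j\<close> of elements of the powers
  \<open>X\<^bsup>Hom(D j, c)\<^esup>\<close>; the transformation from \<open>F\<close> to the power functor that sends \<open>e\<close> to \<open>a\<close> transposes
  to the required map \<open>F c \<rightarrow> X\<close>.
\<close>

lemma freely_generated_imp_pointwise:
  assumes free: "freely_generated \<kappa> J C D F e" and c: "c \<in> Obj C"
  shows "universal_hom_cocone \<kappa> J C D c (OMap F c) (\<lambda>j k. ap (AMap F k) (e j))"
proof -
  have D: "is_functor J C D" and F: "is_functor C (SET \<kappa>) F" and e: "limit_element J (F \<circ>\<^sub>F D) e"
    using free by (auto simp: freely_generated_def)
  interpret D: is_functor J C D by fact
  interpret F: set_functor \<kappa> C F using F by simp
  have ej: "e j \<in> OMap F (OMap D j)" if "j \<in> Obj J" for j using limit_elementD(1)[OF e that] by simp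
  have "\<exists>!h. h \<in> OMap F c \<rightarrow>\<^sub>E X \<and>
      (\<forall>j \<in> Obj J. \<forall>k \<in> Hom C (OMap D j) c. h (ap (AMap F k) (e j)) = \<nu> j k)" (is "\<exists>!h. ?P h")
    if X: "small \<kappa> X" and \<nu>: "hom_cocone J C D c X \<nu>" for X :: "'u set" and \<nu>
  proof -
    let ?H = "power_functor C c X"
    have H: "is_functor C (SET \<kappa>) ?H" by (rule is_functor_power_functor[OF X])
    \<comment> \<open>The cocone, seen as a family of elements of the powers.\<close>
    define a where "a j = power_code c X (OMap D j) (\<lambda>k \<in> Hom C (OMap D j) c. \<nu> j k)" for j
    have \<nu>_in: "(\<lambda>k \<in> Hom C (OMap D j) c. \<nu> j k) \<in> Hom C (OMap D j) c \<rightarrow>\<^sub>E X" if "j \<in> Obj J" for j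
      using hom_coconeD(1)[OF \<nu> that] by auto
    have a: "limit_element J (?H \<circ>\<^sub>F D) a"
      unfolding limit_element_def
    proof (intro conjI ballI allI)
      show "a j \<in> OMap (?H \<circ>\<^sub>F D) j" if "j \<in> Obj J" for j
        using \<nu>_in[OF that] by (simp add: OMap_power_functor a_def)
      fix i j \<phi> assume \<phi>: "\<phi> \<in> Hom J i j"
      then have i: "i \<in> Obj J" using D.dom.Hom_Obj by blast
      have "(\<lambda>l \<in> Hom C (OMap D j) c. (\<lambda>k \<in> Hom C (OMap D i) c. \<nu> i k) (Comp C l (AMap D \<phi>))) =
          (\<lambda>k \<in> Hom C (OMap D j) c. \<nu> j k)"
        using hom_coconeD(2)[OF \<nu> \<phi>] comp_in[OF D.amap_in[OF \<phi>]] by (auto simp: fun_eq_iff)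
      then show "ap (AMap (?H \<circ>\<^sub>F D) \<phi>) (a i) = a j"
        using AMap_power_functor(2)[OF X D.amap_in[OF \<phi>] \<nu>_in[OF i]] by (simp add: a_def)
    qed
    have ex1: "\<exists>!\<sigma>. nat_trans C (SET \<kappa>) F ?H \<sigma> \<and> (\<forall>j \<in> Obj J. ap (\<sigma> (OMap D j)) (e j) = a j)"
      using free H a unfolding freely_generated_def by blast
    then obtain \<sigma> where \<sigma>: "nat_trans C (SET \<kappa>) F ?H \<sigma>"
        and \<sigma>e: "\<And>j. j \<in> Obj J \<Longrightarrow> ap (\<sigma> (OMap D j)) (e j) = a j"
      by blast
    let ?dec = "inv_into (Hom C c c \<rightarrow>\<^sub>E X) (power_code c X c)"
    have dec: "?dec (power_code c X c \<phi>) = \<phi>" if "\<phi> \<in> Hom C c c \<rightarrow>\<^sub>E X" for \<phi>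
      using inv_into_f_f[OF inj_power_code[OF X]] that .
    have Id: "Id C c \<in> Hom C c c" using id_in[OF c] .
    \<comment> \<open>The transpose: decode the function on \<open>Hom(c, c)\<close> and evaluate it at the identity.\<close>
    define h where "h = (\<lambda>x \<in> OMap F c. ?dec (ap (\<sigma> c) x) (Id C c))"
    have "?P h"
    proof (intro conjI ballI)
      have "?dec (ap (\<sigma> c) x) \<in> Hom C c c \<rightarrow>\<^sub>E X" if "x \<in> OMap F c" for x
        using nat_trans_ap_in[OF \<sigma> c that] inv_into_into
        by (fastforce simp: OMap_power_functor dec)
      then show "h \<in> OMap F c \<rightarrow>\<^sub>E X" using Id unfolding h_def by fastforce
      fix j k assume j: "j \<in> Obj J" and k: "k \<in> Hom C (OMap D j) c"
      let ?\<phi> = "\<lambda>l \<in> Hom C c c. (\<lambda>k \<in> Hom C (OMap D j) c. \<nu> j k) (Comp C l k)"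
      have "ap (\<sigma> c) (ap (AMap F k) (e j)) = power_code c X c ?\<phi>"
        using nat_trans_ap_natural[OF \<sigma> k ej[OF j]] \<sigma>e[OF j]
          AMap_power_functor(2)[OF X k \<nu>_in[OF j]] by (simp add: a_def)
      moreover have "?\<phi> \<in> Hom C c c \<rightarrow>\<^sub>E X" using \<nu>_in[OF j] comp_in[OF k] by auto
      ultimately show "h (ap (AMap F k) (e j)) = \<nu> j k"
        using F.act_in[OF k ej[OF j]] Id k id_left[OF k] by (simp add: h_def dec)
    qed
    moreover have "g = g'" if g: "?P g" and g': "?P g'" for g g'
    proof -
      \<comment> \<open>Two solutions have transposes that agree on \<open>e\<close>, hence coincide.\<close>
      let ?\<tau> = "\<lambda>h. set_trans C F ?H (\<lambda>d x. power_code c X d (\<lambda>k \<in> Hom C d c. h (ap (AMap F k) x)))"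
      have \<tau>: "nat_trans C (SET \<kappa>) F ?H (?\<tau> g)" if "?P g" for g
        using that by (intro nat_trans_to_power[OF X F]) auto
      have \<tau>e: "ap (?\<tau> g (OMap D j)) (e j) = a j" if "?P g" "j \<in> Obj J" for g j
      proof -
        have "(\<lambda>k \<in> Hom C (OMap D j) c. g (ap (AMap F k) (e j))) = (\<lambda>k \<in> Hom C (OMap D j) c. \<nu> j k)"
          using that by (auto simp: fun_eq_iff)
        then show ?thesis using D.omap_in[OF that(2)] ej[OF that(2)] by (simp add: a_def)
      qed
      have eq: "?\<tau> g = ?\<tau> g'" using ex1 \<tau>[OF g] \<tau>[OF g'] \<tau>e[OF g] \<tau>e[OF g'] by blast
      \<comment> \<open>Evaluation at the identity undoes the transpose.\<close>
      have recover: "g x = ?dec (ap (?\<tau> g c) x) (Id C c)" if "?P g" and x: "x \<in> OMap F c" for g x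
      proof -
        have "(\<lambda>k \<in> Hom C c c. g (ap (AMap F k) x)) \<in> Hom C c c \<rightarrow>\<^sub>E X"
          using that F.act_in[OF _ x] by auto
        then show ?thesis using c x Id by (simp add: dec F.act_id)
      qed
      have "g x = g' x" if "x \<in> OMap F c" for x
        using recover[OF g that] recover[OF g' that] eq by simp
      then show "g = g'" using g g' by (meson PiE_ext)
    qed
    ultimately show "\<exists>!h. ?P h" by blast
  qed
  then show ?thesis
    using hom_cocone_act[OF D F e] unfolding universal_hom_cocone_def by blast
qed

end


section \<open>Small functors as freely generated functors\<close>

lemma category_op: "category C \<Longrightarrow> category (op_cat C)"
  by (auto simp: category_def op_cat_def Hom_def)

lemma Hom_op [simp]: "Hom (op_cat C) x y = Hom C y x"
  by (auto simp: op_cat_def Hom_def)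

lemma op_cat_simps [simp]: "Obj (op_cat C) = Obj C" "Id (op_cat C) = Id C"
    "Comp (op_cat C) g f = Comp C f g"
  by (simp_all add: op_cat_def)

context locally_small_category
begin

lemma inj_code_Hom: "inj_on (code (Hom C x y) :: 'a \<Rightarrow> 'u) (Hom C x y)"
  by (rule inj_on_code[OF universe small_Hom])

lemma small_hom_set: "small \<kappa> (hom_set C x y :: 'u set)"
  unfolding hom_set_def by (rule small_image[OF small_Hom])

text \<open>
  On codes of arrows, \<open>hom_map C f g\<close> is composition with \<open>f\<close> and \<open>g\<close>.  Since every element of
  \<open>hom_set\<close> is such a code, the definition of \<open>hom_map\<close> is not unfolded after this point.
\<close>

lemma hom_map_arr:
  assumes f: "f \<in> Hom C x' x" and g: "g \<in> Hom C y y'"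
  shows "(hom_map C f g :: 'u set_arr) \<in> Hom (SET \<kappa>) (hom_set C x y) (hom_set C x' y')"
    and "k \<in> Hom C x y \<Longrightarrow> ap (hom_map C f g) (code (Hom C x y) k :: 'u) =
      code (Hom C x' y') (Comp C g (Comp C k f))"
proof -
  have d: "Dom C f = x'" "Cod C f = x" "Dom C g = y" "Cod C g = y'" using f g by (auto simp: in_Hom)
  let ?i = "inv_into (Hom C x y) (code (Hom C x y) :: 'a \<Rightarrow> 'u)"
  have eq: "(hom_map C f g :: 'u set_arr) = (hom_set C x y,
      (\<lambda>u \<in> hom_set C x y. code (Hom C x' y') (Comp C g (Comp C (?i u) f))), hom_set C x' y')"
    by (simp add: hom_map_def d)
  have inv: "?i (code (Hom C x y) k) = k" if "k \<in> Hom C x y" for k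
    using inv_into_f_f[OF inj_code_Hom that] .
  show "(hom_map C f g :: 'u set_arr) \<in> Hom (SET \<kappa>) (hom_set C x y) (hom_set C x' y')"
    unfolding eq
  proof (rule Hom_SET_I[OF small_hom_set small_hom_set])
    fix u :: 'u assume "u \<in> hom_set C x y"
    then obtain k where k: "k \<in> Hom C x y" and u: "u = code (Hom C x y) k"
      unfolding hom_set_def by auto
    show "code (Hom C x' y') (Comp C g (Comp C (?i u) f)) \<in> hom_set C x' y'"
      unfolding hom_set_def u inv[OF k] by (intro imageI comp_in[OF comp_in[OF f k] g])
  qed
  show "ap (hom_map C f g) (code (Hom C x y) k :: 'u) =
      code (Hom C x' y') (Comp C g (Comp C k f))" if k: "k \<in> Hom C x y"
    unfolding eq using inv[OF k] k by (simp add: hom_set_def)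
qed

lemma is_functor_representable:
  assumes x: "x \<in> Obj C"
  shows "is_functor C (SET \<kappa>) (representable C x)"
proof (rule set_functorI)
  show "category C" by unfold_locales
  show "small \<kappa> (OMap (representable C x :: ('o, 'a, 'u set, 'u set_arr) func) y)" for y
    by (simp add: representable_def small_hom_set)
  show "AMap (representable C x) f \<in> Hom (SET \<kappa>) (OMap (representable C x) y)
      (OMap (representable C x) z)" if "f \<in> Hom C y z" for f y z
    using hom_map_arr(1)[OF id_in[OF x] that] by (simp add: representable_def)
next
  fix y and u :: 'u assume y: "y \<in> Obj C" and "u \<in> OMap (representable C x) y"
  then obtain k where k: "k \<in> Hom C x y" "u = code (Hom C x y) k"
    by (auto simp: representable_def hom_set_def)
  then show "ap (AMap (representable C x) (Id C y)) u = u"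
    using hom_map_arr(2)[OF id_in[OF x] id_in[OF y] k(1)]
    by (simp add: representable_def id_right[OF k(1)] id_left[OF k(1)])
next
  fix f g y z w and u :: 'u
  assume f: "f \<in> Hom C y z" and g: "g \<in> Hom C z w" and "u \<in> OMap (representable C x) y"
  then obtain k where k: "k \<in> Hom C x y" "u = code (Hom C x y) k"
    by (auto simp: representable_def hom_set_def)
  show "ap (AMap (representable C x) (Comp C g f)) u =
      ap (AMap (representable C x) g) (ap (AMap (representable C x) f) u)"
    using hom_map_arr(2)[OF id_in[OF x] comp_in[OF f g] k(1)]
      hom_map_arr(2)[OF id_in[OF x] f k(1)] hom_map_arr(2)[OF id_in[OF x] g comp_in[OF k(1) f]]
    by (simp add: representable_def k(2) id_right[OF k(1)] id_right[OF comp_in[OF k(1) f]]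
        comp_assoc[OF k(1) f g])
qed

lemma is_functor_hom_diagram:
  fixes D :: "('j, 'b, 'o, 'a) func"
  assumes D: "is_functor J C D" and c: "c \<in> Obj C"
  shows "is_functor (op_cat J) (SET \<kappa>) (hom_diagram C D c)"
proof -
  interpret D: is_functor J C D by fact
  note Idc = id_in[OF c]
  show ?thesis
  proof (rule set_functorI)
    show "category (op_cat J)" by (rule category_op) unfold_locales
    show "small \<kappa> (OMap (hom_diagram C D c :: ('j, 'b, 'u set, 'u set_arr) func) j)" for j
      by (simp add: hom_diagram_def small_hom_set)
    show "AMap (hom_diagram C D c) \<phi> \<in> Hom (SET \<kappa>) (OMap (hom_diagram C D c) i)
        (OMap (hom_diagram C D c) j)" if "\<phi> \<in> Hom (op_cat J) i j" for \<phi> i j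
      using hom_map_arr(1)[OF D.amap_in Idc] that by (simp add: hom_diagram_def)
  next
    fix j and u :: 'u assume j: "j \<in> Obj (op_cat J)" and "u \<in> OMap (hom_diagram C D c) j"
    then obtain k where k: "k \<in> Hom C (OMap D j) c" "u = code (Hom C (OMap D j) c) k"
      by (auto simp: hom_diagram_def hom_set_def)
    then show "ap (AMap (hom_diagram C D c) (Id (op_cat J) j)) u = u"
      using hom_map_arr(2)[OF id_in[OF D.omap_in] Idc k(1)] j
      by (simp add: hom_diagram_def D.amap_id id_right[OF k(1)] id_left[OF k(1)])
  next
    fix \<phi> \<psi> i j l and u :: 'u
    assume "\<phi> \<in> Hom (op_cat J) i j" "\<psi> \<in> Hom (op_cat J) j l" and "u \<in> OMap (hom_diagram C D c) i"
    then obtain k where \<phi>: "\<phi> \<in> Hom J j i" and \<psi>: "\<psi> \<in> Hom J l j"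
        and k: "k \<in> Hom C (OMap D i) c" "u = code (Hom C (OMap D i) c) k"
      by (auto simp: hom_diagram_def hom_set_def)
    note kf = comp_in[OF D.amap_in[OF \<phi>] k(1)]
    note kfg = comp_in[OF D.amap_in[OF \<psi>] kf]
    show "ap (AMap (hom_diagram C D c) (Comp (op_cat J) \<psi> \<phi>)) u =
        ap (AMap (hom_diagram C D c) \<psi>) (ap (AMap (hom_diagram C D c) \<phi>) u)"
      using hom_map_arr(2)[OF D.amap_in[OF D.dom.comp_in[OF \<psi> \<phi>]] Idc k(1)]
        hom_map_arr(2)[OF D.amap_in[OF \<phi>] Idc k(1)] hom_map_arr(2)[OF D.amap_in[OF \<psi>] Idc kf]
      by (simp add: hom_diagram_def k(2) D.amap_comp[OF \<psi> \<phi>] id_left[OF kf] id_left[OF kfg]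
          comp_assoc[OF D.amap_in[OF \<psi>] D.amap_in[OF \<phi>] k(1)])
  qed
qed

text \<open>
  Decoding of cocones in \<open>SET\<close>: \<open>T j\<close> and \<open>t j\<close> are the same map, on codes and on arrows respectively.
\<close>

lemma is_cocone_iff_hom_cocone:
  assumes D: "is_functor J C D" and c: "c \<in> Obj C" and X: "small \<kappa> X"
    and T: "\<And>j. j \<in> Obj J \<Longrightarrow> T j \<in> Hom (SET \<kappa>) (hom_set C (OMap D j) c) X"
    and t: "\<And>j k. \<lbrakk>j \<in> Obj J; k \<in> Hom C (OMap D j) c\<rbrakk>
      \<Longrightarrow> ap (T j) (code (Hom C (OMap D j) c) k) = t j k"
  shows "is_cocone (op_cat J) (SET \<kappa>) (hom_diagram C D c) X T \<longleftrightarrow> hom_cocone J C D c X t"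
proof -
  interpret D: is_functor J C D by fact
  interpret S: category "SET \<kappa>" by (rule category_SET)
  have t_in: "t j k \<in> X" if j: "j \<in> Obj J" and k: "k \<in> Hom C (OMap D j) c" for j k
    using ap_in[OF T[OF j]] t[OF j k] k by (fastforce simp: hom_set_def)
  have compat: "Comp (SET \<kappa>) (T i) (AMap (hom_diagram C D c) \<phi>) = T j \<longleftrightarrow>
      (\<forall>k \<in> Hom C (OMap D j) c. t i (Comp C k (AMap D \<phi>)) = t j k)" if \<phi>: "\<phi> \<in> Hom J i j" for \<phi> i j
  proof -
    have ij: "i \<in> Obj J" "j \<in> Obj J" using D.dom.Hom_Obj[OF \<phi>] by auto
    have m: "AMap (hom_diagram C D c) \<phi> \<in>
        Hom (SET \<kappa>) (hom_set C (OMap D j) c) (hom_set C (OMap D i) c)"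
      using hom_map_arr(1)[OF D.amap_in[OF \<phi>] id_in[OF c]] by (simp add: hom_diagram_def)
    have val: "ap (Comp (SET \<kappa>) (T i) (AMap (hom_diagram C D c) \<phi>)) (code (Hom C (OMap D j) c) k) =
        t i (Comp C k (AMap D \<phi>))" if k: "k \<in> Hom C (OMap D j) c" for k
    proof -
      note k\<phi> = comp_in[OF D.amap_in[OF \<phi>] k]
      have "(code (Hom C (OMap D j) c) k :: 'u) \<in> hom_set C (OMap D j) c" using k by (simp add: hom_set_def)
      then show ?thesis
        using ap_Comp[OF m T[OF ij(1)]] hom_map_arr(2)[OF D.amap_in[OF \<phi>] id_in[OF c] k]
          t[OF ij(1) k\<phi>] id_left[OF k\<phi>]
        by (simp add: hom_diagram_def)
    qed
    show ?thesis
    proof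
      assume "Comp (SET \<kappa>) (T i) (AMap (hom_diagram C D c) \<phi>) = T j"
      then show "\<forall>k \<in> Hom C (OMap D j) c. t i (Comp C k (AMap D \<phi>)) = t j k"
        using val t[OF ij(2)] by metis
    next
      assume eq: "\<forall>k \<in> Hom C (OMap D j) c. t i (Comp C k (AMap D \<phi>)) = t j k"
      show "Comp (SET \<kappa>) (T i) (AMap (hom_diagram C D c) \<phi>) = T j"
      proof (rule SET_arr_eqI[OF S.comp_in[OF m T[OF ij(1)]] T[OF ij(2)]])
        fix u :: 'u assume "u \<in> hom_set C (OMap D j) c"
        then obtain k where "k \<in> Hom C (OMap D j) c" "u = code (Hom C (OMap D j) c) k"
          by (auto simp: hom_set_def)
        then show "ap (Comp (SET \<kappa>) (T i) (AMap (hom_diagram C D c) \<phi>)) u = ap (T j) u"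
          using val t[OF ij(2)] eq by simp
      qed
    qed
  qed
  have T': "\<forall>j \<in> Obj J. T j \<in> Hom (SET \<kappa>) (OMap (hom_diagram C D c) j) X"
    using T by (simp add: hom_diagram_def)
  show ?thesis
    unfolding is_cocone_def hom_cocone_def
    using is_functor_hom_diagram[OF D c] X T' t_in compat by auto
qed

lemma is_colimit_iff_universal:
  fixes D :: "('j, 'b, 'o, 'a) func"
  assumes D: "is_functor J C D" and c: "c \<in> Obj C" and L: "small \<kappa> L"
    and T: "\<And>j. j \<in> Obj J \<Longrightarrow> T j \<in> Hom (SET \<kappa>) (hom_set C (OMap D j) c) L"
    and t: "\<And>j k. \<lbrakk>j \<in> Obj J; k \<in> Hom C (OMap D j) c\<rbrakk>
      \<Longrightarrow> ap (T j) (code (Hom C (OMap D j) c) k) = t j k"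
  shows "is_colimit (op_cat J) (SET \<kappa>) (hom_diagram C D c) L T \<longleftrightarrow>
    universal_hom_cocone \<kappa> J C D c L t"
proof -
  interpret S: category "SET \<kappa>" by (rule category_SET)
  let ?\<Delta> = "hom_diagram C D c :: ('j, 'b, 'u set, 'u set_arr) func"
  \<comment> \<open>Mediating arrows in \<open>SET\<close> are mediating functions on uncoded arrows.\<close>
  have mediating: "(\<exists>!m. m \<in> Hom (SET \<kappa>) L X \<and> (\<forall>j \<in> Obj (op_cat J). Comp (SET \<kappa>) m (T j) = N j)) \<longleftrightarrow>
      (\<exists>!h. h \<in> L \<rightarrow>\<^sub>E X \<and> (\<forall>j \<in> Obj J. \<forall>k \<in> Hom C (OMap D j) c. h (t j k) = \<nu> j k))"
    if X: "small \<kappa> X" and N: "\<And>j. j \<in> Obj J \<Longrightarrow> N j \<in> Hom (SET \<kappa>) (hom_set C (OMap D j) c) X"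
      and \<nu>: "\<And>j k. \<lbrakk>j \<in> Obj J; k \<in> Hom C (OMap D j) c\<rbrakk>
        \<Longrightarrow> ap (N j) (code (Hom C (OMap D j) c) k) = \<nu> j k"
    for X N \<nu>
  proof -
    have Comp_eq: "Comp (SET \<kappa>) (L, h, X) (T j) = N j \<longleftrightarrow>
        (\<forall>k \<in> Hom C (OMap D j) c. h (t j k) = \<nu> j k)" if h: "h \<in> L \<rightarrow>\<^sub>E X" and j: "j \<in> Obj J" for h j
    proof -
      have m: "(L, h, X) \<in> Hom (SET \<kappa>) L X" using h L X by (simp add: in_Hom_SET)
      have val: "ap (Comp (SET \<kappa>) (L, h, X) (T j)) (code (Hom C (OMap D j) c) k) = h (t j k)"
        if k: "k \<in> Hom C (OMap D j) c" for k
        using ap_Comp[OF T[OF j] m] t[OF j k] k by (simp add: hom_set_def ap_def)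
      show ?thesis
      proof
        assume "Comp (SET \<kappa>) (L, h, X) (T j) = N j"
        then show "\<forall>k \<in> Hom C (OMap D j) c. h (t j k) = \<nu> j k" using val \<nu>[OF j] by metis
      next
        assume eq: "\<forall>k \<in> Hom C (OMap D j) c. h (t j k) = \<nu> j k"
        show "Comp (SET \<kappa>) (L, h, X) (T j) = N j"
        proof (rule SET_arr_eqI[OF S.comp_in[OF T[OF j] m] N[OF j]])
          fix u :: 'u assume "u \<in> hom_set C (OMap D j) c"
          then obtain k where "k \<in> Hom C (OMap D j) c" "u = code (Hom C (OMap D j) c) k"
            by (auto simp: hom_set_def)
          then show "ap (Comp (SET \<kappa>) (L, h, X) (T j)) u = ap (N j) u"
            using val \<nu>[OF j] eq by simp
        qed
      qed
    qed
    have "(\<exists>!m. m \<in> Hom (SET \<kappa>) L X \<and> (\<forall>j \<in> Obj J. Comp (SET \<kappa>) m (T j) = N j)) \<longleftrightarrow>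
        (\<exists>!h. h \<in> L \<rightarrow>\<^sub>E X \<and> (\<forall>j \<in> Obj J. Comp (SET \<kappa>) (L, h, X) (T j) = N j))"
      by (rule ex1_Hom_SET[OF L X])
    also have "\<dots> \<longleftrightarrow>
        (\<exists>!h. h \<in> L \<rightarrow>\<^sub>E X \<and> (\<forall>j \<in> Obj J. \<forall>k \<in> Hom C (OMap D j) c. h (t j k) = \<nu> j k))"
      using Comp_eq by (intro arg_cong[where f = Ex1] ext) auto
    finally show ?thesis by simp
  qed
  have cocone_L: "is_cocone (op_cat J) (SET \<kappa>) ?\<Delta> L T \<longleftrightarrow> hom_cocone J C D c L t"
    by (rule is_cocone_iff_hom_cocone[OF D c L T t])
  show ?thesis
  proof
    assume lim: "is_colimit (op_cat J) (SET \<kappa>) ?\<Delta> L T"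
    have "\<exists>!h. h \<in> L \<rightarrow>\<^sub>E X \<and> (\<forall>j \<in> Obj J. \<forall>k \<in> Hom C (OMap D j) c. h (t j k) = \<nu> j k)"
      if X: "small \<kappa> X" and \<nu>: "hom_cocone J C D c X \<nu>" for X :: "'u set" and \<nu>
    proof -
      let ?h = "\<lambda>j. hom_set C (OMap D j) c :: 'u set"
      let ?dec = "\<lambda>j. inv_into (Hom C (OMap D j) c) (code (Hom C (OMap D j) c) :: 'a \<Rightarrow> 'u)"
      define N where "N j = (?h j, (\<lambda>u \<in> ?h j. \<nu> j (?dec j u)), X)" for j
      have dec: "?dec j (code (Hom C (OMap D j) c) k) = k" if "k \<in> Hom C (OMap D j) c" for j k
        using inv_into_f_f[OF inj_code_Hom that] .
      have N: "N j \<in> Hom (SET \<kappa>) (?h j) X" if "j \<in> Obj J" for j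
        unfolding N_def
        by (rule Hom_SET_I[OF small_hom_set X])
          (use hom_coconeD(1)[OF \<nu> that] dec in \<open>auto simp: hom_set_def\<close>)
      have N\<nu>: "ap (N j) (code (Hom C (OMap D j) c) k) = \<nu> j k" if "k \<in> Hom C (OMap D j) c" for j k
        using that dec[OF that] by (simp add: N_def hom_set_def)
      have "is_cocone (op_cat J) (SET \<kappa>) ?\<Delta> X N"
        using is_cocone_iff_hom_cocone[OF D c X N N\<nu>] \<nu> by blast
      then have "\<exists>!m. m \<in> Hom (SET \<kappa>) L X \<and> (\<forall>j \<in> Obj (op_cat J). Comp (SET \<kappa>) m (T j) = N j)"
        using lim by (simp add: is_colimit_def)
      then show ?thesis by (simp only: mediating[OF X N N\<nu>])
    qed
    then show "universal_hom_cocone \<kappa> J C D c L t"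
      unfolding universal_hom_cocone_def using lim cocone_L
      by (intro conjI allI impI) (simp_all add: is_colimit_def)
  next
    assume U: "universal_hom_cocone \<kappa> J C D c L t"
    have "\<exists>!m. m \<in> Hom (SET \<kappa>) L X \<and> (\<forall>j \<in> Obj (op_cat J). Comp (SET \<kappa>) m (T j) = N j)"
      if coc: "is_cocone (op_cat J) (SET \<kappa>) ?\<Delta> X N" for X N
    proof -
      have X: "small \<kappa> X" and N: "\<And>j. j \<in> Obj J \<Longrightarrow> N j \<in> Hom (SET \<kappa>) (hom_set C (OMap D j) c) X"
        using coc by (auto simp: is_cocone_def hom_diagram_def)
      define \<nu> where "\<nu> j k = ap (N j) (code (Hom C (OMap D j) c) k)" for j k
      have "hom_cocone J C D c X \<nu>"
        using is_cocone_iff_hom_cocone[OF D c X N, of \<nu>] coc by (simp add: \<nu>_def)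
      then have "\<exists>!h. h \<in> L \<rightarrow>\<^sub>E X \<and> (\<forall>j \<in> Obj J. \<forall>k \<in> Hom C (OMap D j) c. h (t j k) = \<nu> j k)"
        using U X by (simp add: universal_hom_cocone_def)
      then show ?thesis by (subst mediating[OF X N \<nu>_def[symmetric]])
    qed
    then show "is_colimit (op_cat J) (SET \<kappa>) ?\<Delta> L T"
      unfolding is_colimit_def using U cocone_L
      by (intro conjI allI impI) (simp_all add: universal_hom_cocone_def)
  qed
qed

text \<open>
  The surjective half of the Yoneda lemma: every element of \<open>F x\<close> is the image of the identity under
  some transformation.
\<close>

lemma ex_yoneda_transformation:
  assumes F: "is_functor C (SET \<kappa>) F" and x: "x \<in> Obj C" and a: "a \<in> OMap F x"
  shows "\<exists>\<mu>. nat_trans C (SET \<kappa>) (representable C x) F \<mu> \<and>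
    (\<forall>c k. k \<in> Hom C x c \<longrightarrow> ap (\<mu> c) (code (Hom C x c) k) = ap (AMap F k) a)"
proof -
  interpret F: set_functor \<kappa> C F using F by simp
  let ?R = "representable C x :: ('o, 'a, 'u set, 'u set_arr) func"
  define t where "t c u = ap (AMap F (inv_into (Hom C x c) (code (Hom C x c)) u)) a" for c and u :: 'u
  have t: "t c (code (Hom C x c) k) = ap (AMap F k) a" if "k \<in> Hom C x c" for c k
    using inv_into_f_f[OF inj_code_Hom that] by (simp add: t_def)
  have R: "\<exists>k \<in> Hom C x c. u = code (Hom C x c) k" if "u \<in> OMap ?R c" for c u
    using that by (auto simp: representable_def hom_set_def)
  have "nat_trans C (SET \<kappa>) ?R F (set_trans C ?R F t)"
  proof (rule nat_trans_set_trans[OF is_functor_representable[OF x] F])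
    show "t c u \<in> OMap F c" if "u \<in> OMap ?R c" for c u
      using R[OF that] t F.act_in[OF _ a] by auto
    fix f c d u assume f: "f \<in> Hom C c d" and "u \<in> OMap ?R c"
    then obtain k where k: "k \<in> Hom C x c" "u = code (Hom C x c) k" using R by blast
    show "t d (ap (AMap ?R f) u) = ap (AMap F f) (t c u)"
      using hom_map_arr(2)[OF id_in[OF x] f k(1)] t[OF k(1)] t[OF comp_in[OF k(1) f]]
        F.act_comp[OF k(1) f a]
      by (simp add: representable_def k(2) id_right[OF k(1)])
  qed
  moreover have "ap (set_trans C ?R F t c) (code (Hom C x c) k) = ap (AMap F k) a"
    if "k \<in> Hom C x c" for c k
  proof -
    have "code (Hom C x c) k \<in> OMap ?R c" using that by (simp add: representable_def hom_set_def)
    then show ?thesis using Hom_Obj[OF that] t[OF that] by simp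
  qed
  ultimately show ?thesis by blast
qed

text \<open>
  The injective half of the Yoneda lemma: \<open>k\<close> is the image of the identity under the action of \<open>k\<close>, so
  naturality determines \<open>\<mu>\<close> from its value at the identity.
\<close>

lemma yoneda_value:
  assumes F: "is_functor C (SET \<kappa>) F" and \<mu>: "nat_trans C (SET \<kappa>) (representable C x) F \<mu>"
    and k: "k \<in> Hom C x c"
  shows "ap (\<mu> c) (code (Hom C x c) k :: 'u) = ap (AMap F k) (ap (\<mu> x) (code (Hom C x x) (Id C x)))"
proof -
  have x: "x \<in> Obj C" using Hom_Obj[OF k] by blast
  have "code (Hom C x x) (Id C x) \<in> OMap (representable C x) x"
    using id_in[OF x] by (simp add: representable_def hom_set_def)
  moreover have "ap (AMap (representable C x) k) (code (Hom C x x) (Id C x) :: 'u) =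
      code (Hom C x c) k"
    using hom_map_arr(2)[OF id_in[OF x] k id_in[OF x]] id_right[OF k] id_left[OF id_in[OF x]]
    by (simp add: representable_def)
  ultimately show ?thesis using nat_trans_ap_natural[OF \<mu> k] by metis
qed

text \<open>
  The transformations \<open>\<mu> j\<close> and the elements \<open>e j\<close> determine each other by Yoneda, and under this
  correspondence the pointwise colimit condition becomes free generation.
\<close>

lemma pointwise_colimit_iff_freely_generated:
  assumes D: "is_functor J C D" and F: "is_functor C (SET \<kappa>) F"
    and \<mu>: "\<And>j. j \<in> Obj J \<Longrightarrow> nat_trans C (SET \<kappa>) (representable C (OMap D j)) F (\<mu> j)"
    and e: "\<And>j. j \<in> Obj J \<Longrightarrow> e j \<in> OMap F (OMap D j)"
    and \<mu>e: "\<And>j c k. \<lbrakk>j \<in> Obj J; k \<in> Hom C (OMap D j) c\<rbrakk>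
      \<Longrightarrow> ap (\<mu> j c) (code (Hom C (OMap D j) c) k) = ap (AMap F k) (e j)"
  shows "(\<forall>c \<in> Obj C. is_colimit (op_cat J) (SET \<kappa>) (hom_diagram C D c) (OMap F c) (\<lambda>j. \<mu> j c)) \<longleftrightarrow>
    freely_generated \<kappa> J C D F e"
proof -
  interpret D: is_functor J C D by fact
  interpret F: set_functor \<kappa> C F using F by simp
  have comp: "\<mu> j c \<in> Hom (SET \<kappa>) (hom_set C (OMap D j) c) (OMap F c)"
    if "j \<in> Obj J" "c \<in> Obj C" for j c
    using nat_trans.component_in[OF \<mu>] that by (fastforce simp: representable_def)
  have iff: "is_colimit (op_cat J) (SET \<kappa>) (hom_diagram C D c) (OMap F c) (\<lambda>j. \<mu> j c) \<longleftrightarrow>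
      universal_hom_cocone \<kappa> J C D c (OMap F c) (\<lambda>j k. ap (AMap F k) (e j))" if c: "c \<in> Obj C" for c
    using is_colimit_iff_universal[OF D c F.small_value[OF c] comp[OF _ c] \<mu>e] by simp
  show ?thesis
  proof
    assume lim: "\<forall>c \<in> Obj C. is_colimit (op_cat J) (SET \<kappa>) (hom_diagram C D c) (OMap F c) (\<lambda>j. \<mu> j c)"
    then have U: "universal_hom_cocone \<kappa> J C D c (OMap F c) (\<lambda>j k. ap (AMap F k) (e j))"
      if "c \<in> Obj C" for c
      using iff that by blast
    have "limit_element J (F \<circ>\<^sub>F D) e"
      unfolding limit_element_def
    proof (intro conjI ballI allI)
      fix i j \<phi> assume \<phi>: "\<phi> \<in> Hom J i j"
      then have ij: "i \<in> Obj J" "j \<in> Obj J" using D.dom.Hom_Obj by blast+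
      note Dj = D.omap_in[OF ij(2)]
      have "hom_cocone J C D (OMap D j) (OMap F (OMap D j)) (\<lambda>j k. ap (AMap F k) (e j))"
        using U[OF Dj] unfolding universal_hom_cocone_def by blast
      from hom_coconeD(2)[OF this \<phi> id_in[OF Dj]] show "ap (AMap (F \<circ>\<^sub>F D) \<phi>) (e i) = e j"
        using id_left[OF D.amap_in[OF \<phi>]] F.act_id[OF Dj e[OF ij(2)]] by simp
    qed (simp add: e)
    then show "freely_generated \<kappa> J C D F e" by (rule pointwise_imp_freely_generated[OF D F _ U])
  next
    assume "freely_generated \<kappa> J C D F e"
    then show "\<forall>c \<in> Obj C. is_colimit (op_cat J) (SET \<kappa>) (hom_diagram C D c) (OMap F c) (\<lambda>j. \<mu> j c)"
      using iff freely_generated_imp_pointwise by blast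
  qed
qed

theorem small_functor_iff_freely_generated:
  assumes F: "is_functor C (SET \<kappa>) F"
  shows "small_functor \<kappa> C F \<longleftrightarrow>
    (\<exists>(J :: ('u, 'u) cat) D e. small_category \<kappa> J \<and> freely_generated \<kappa> J C D F e)"
proof
  assume "small_functor \<kappa> C F"
  then obtain J :: "('u, 'u) cat" and D \<mu> where J: "small_category \<kappa> J" and D: "is_functor J C D"
    and \<mu>: "\<And>j. j \<in> Obj J \<Longrightarrow> nat_trans C (SET \<kappa>) (representable C (OMap D j)) F (\<mu> j)"
    and lim: "\<forall>c \<in> Obj C. is_colimit (op_cat J) (SET \<kappa>) (hom_diagram C D c) (OMap F c) (\<lambda>j. \<mu> j c)"
    unfolding small_functor_def by blast
  define e where "e j = ap (\<mu> j (OMap D j)) (code (Hom C (OMap D j) (OMap D j)) (Id C (OMap D j)))" for j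
  have "e j \<in> OMap F (OMap D j)" if j: "j \<in> Obj J" for j
    unfolding e_def
    by (rule nat_trans_ap_in[OF \<mu>[OF j]])
      (use id_in is_functor.omap_in[OF D j] in \<open>auto simp: representable_def hom_set_def\<close>)
  then have "freely_generated \<kappa> J C D F e"
    using pointwise_colimit_iff_freely_generated[OF D F \<mu>, of e] lim yoneda_value[OF F \<mu>]
    by (simp add: e_def)
  then show "\<exists>(J :: ('u, 'u) cat) D e. small_category \<kappa> J \<and> freely_generated \<kappa> J C D F e"
    using J by blast
next
  assume "\<exists>(J :: ('u, 'u) cat) D e. small_category \<kappa> J \<and> freely_generated \<kappa> J C D F e"
  then obtain J :: "('u, 'u) cat" and D e where J: "small_category \<kappa> J"
    and free: "freely_generated \<kappa> J C D F e"
    by blast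
  have D: "is_functor J C D" and e: "\<And>j. j \<in> Obj J \<Longrightarrow> e j \<in> OMap F (OMap D j)"
    using free by (auto simp: freely_generated_def limit_element_def)
  have "\<forall>j \<in> Obj J. \<exists>\<mu>. nat_trans C (SET \<kappa>) (representable C (OMap D j)) F \<mu> \<and>
      (\<forall>c k. k \<in> Hom C (OMap D j) c \<longrightarrow> ap (\<mu> c) (code (Hom C (OMap D j) c) k) = ap (AMap F k) (e j))"
    using ex_yoneda_transformation[OF F is_functor.omap_in[OF D] e] by blast
  then obtain \<mu> where \<mu>: "\<And>j. j \<in> Obj J \<Longrightarrow> nat_trans C (SET \<kappa>) (representable C (OMap D j)) F (\<mu> j)"
    and \<mu>e: "\<And>j c k. \<lbrakk>j \<in> Obj J; k \<in> Hom C (OMap D j) c\<rbrakk>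
      \<Longrightarrow> ap (\<mu> j c) (code (Hom C (OMap D j) c) k) = ap (AMap F k) (e j)"
    by metis
  show "small_functor \<kappa> C F"
    using pointwise_colimit_iff_freely_generated[OF D F \<mu> e \<mu>e] free F J D \<mu>
    unfolding small_functor_def by blast
qed

end


section \<open>Free generation and Kan extension\<close>

text \<open>
  This is the chain of bijections \<open>Nat(F, H) \<cong> Nat(G, H \<circ> K) \<cong> lim (H \<circ> K \<circ> D)\<close>; the work consists in
  checking that the composite is evaluation at the elements \<open>\<eta> (e j)\<close>.
\<close>

theorem freely_generated_left_kan_extension:
  assumes free: "freely_generated \<kappa> J B D G e"
    and kan: "is_left_kan_extension B C (SET \<kappa>) K G F \<eta>"
  shows "freely_generated \<kappa> J C (K \<circ>\<^sub>F D) F (\<lambda>j. ap (\<eta> (OMap D j)) (e j))"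
proof -
  have D: "is_functor J B D" and G: "is_functor B (SET \<kappa>) G" and e: "limit_element J (G \<circ>\<^sub>F D) e"
    using free by (auto simp: freely_generated_def)
  have K: "is_functor B C K" and \<eta>: "nat_trans B (SET \<kappa>) G (F \<circ>\<^sub>F K) \<eta>"
    and F: "is_functor C (SET \<kappa>) F"
    using kan by (auto simp: is_left_kan_extension_def)
  interpret D: is_functor J B D by fact
  interpret K: is_functor B C K by fact
  interpret S: category "SET \<kappa>" by (rule category_SET)
  let ?e = "\<lambda>j. ap (\<eta> (OMap D j)) (e j)"
  have e_in: "e j \<in> OMap G (OMap D j)" if "j \<in> Obj J" for j
    using limit_elementD(1)[OF e that] by simp
  have e': "limit_element J (F \<circ>\<^sub>F (K \<circ>\<^sub>F D)) ?e"
    unfolding limit_element_def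
  proof (intro conjI ballI allI)
    show "?e j \<in> OMap (F \<circ>\<^sub>F (K \<circ>\<^sub>F D)) j" if "j \<in> Obj J" for j
      using nat_trans_ap_in[OF \<eta> D.omap_in[OF that] e_in[OF that]] by simp
    fix i j \<phi> assume \<phi>: "\<phi> \<in> Hom J i j"
    then have i: "i \<in> Obj J" using D.dom.Hom_Obj by blast
    show "ap (AMap (F \<circ>\<^sub>F (K \<circ>\<^sub>F D)) \<phi>) (?e i) = ?e j"
      using nat_trans_ap_natural[OF \<eta> D.amap_in[OF \<phi>] e_in[OF i]] limit_elementD(2)[OF e \<phi>] by simp
  qed
  have "\<exists>!\<sigma>. nat_trans C (SET \<kappa>) F H \<sigma> \<and> (\<forall>j \<in> Obj J. ap (\<sigma> (OMap (K \<circ>\<^sub>F D) j)) (?e j) = a j)"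
    if H: "is_functor C (SET \<kappa>) H" and a: "limit_element J (H \<circ>\<^sub>F (K \<circ>\<^sub>F D)) a" for H a
  proof -
    have HK: "is_functor B (SET \<kappa>) (H \<circ>\<^sub>F K)" by (rule is_functor_comp[OF K H])
    have "limit_element J ((H \<circ>\<^sub>F K) \<circ>\<^sub>F D) a" using a by (simp add: comp_functor_assoc)
    then have ex1: "\<exists>!\<alpha>. nat_trans B (SET \<kappa>) G (H \<circ>\<^sub>F K) \<alpha> \<and> (\<forall>j \<in> Obj J. ap (\<alpha> (OMap D j)) (e j) = a j)"
      using free HK by (simp add: freely_generated_def)
    then obtain \<alpha> where \<alpha>: "nat_trans B (SET \<kappa>) G (H \<circ>\<^sub>F K) \<alpha>"
        and \<alpha>e: "\<And>j. j \<in> Obj J \<Longrightarrow> ap (\<alpha> (OMap D j)) (e j) = a j"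
      by blast
    have "(\<forall>b \<in> Obj B. Comp (SET \<kappa>) (\<sigma> (OMap K b)) (\<eta> b) = \<alpha> b) \<longleftrightarrow>
        (\<forall>j \<in> Obj J. ap (\<sigma> (OMap (K \<circ>\<^sub>F D) j)) (?e j) = a j)"
      if \<sigma>: "nat_trans C (SET \<kappa>) F H \<sigma>" for \<sigma>
    proof -
      have \<eta>_in: "\<eta> b \<in> Hom (SET \<kappa>) (OMap G b) (OMap F (OMap K b))"
        and \<sigma>_in: "\<sigma> (OMap K b) \<in> Hom (SET \<kappa>) (OMap F (OMap K b)) (OMap H (OMap K b))"
        and \<alpha>_in: "\<alpha> b \<in> Hom (SET \<kappa>) (OMap G b) (OMap H (OMap K b))" if "b \<in> Obj B" for b
        using nat_trans.component_in[OF \<eta> that] nat_trans.component_in[OF \<alpha> that]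
          nat_trans.component_in[OF \<sigma> K.omap_in[OF that]] by simp_all
      show ?thesis
      proof
        assume eq: "\<forall>b \<in> Obj B. Comp (SET \<kappa>) (\<sigma> (OMap K b)) (\<eta> b) = \<alpha> b"
        show "\<forall>j \<in> Obj J. ap (\<sigma> (OMap (K \<circ>\<^sub>F D) j)) (?e j) = a j"
        proof
          fix j assume j: "j \<in> Obj J"
          note Dj = D.omap_in[OF j]
          show "ap (\<sigma> (OMap (K \<circ>\<^sub>F D) j)) (?e j) = a j"
            using ap_Comp[OF \<eta>_in[OF Dj] \<sigma>_in[OF Dj] e_in[OF j]] eq Dj \<alpha>e[OF j] by simp
        qed
      next
        assume eq: "\<forall>j \<in> Obj J. ap (\<sigma> (OMap (K \<circ>\<^sub>F D) j)) (?e j) = a j"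
        \<comment> \<open>The composite \<open>(\<sigma> K) \<circ> \<eta>\<close>, which agrees with \<open>\<alpha>\<close> on the generators \<open>e\<close> of \<open>G\<close>.\<close>
        let ?\<beta> = "set_trans B G (H \<circ>\<^sub>F K) (\<lambda>b x. ap (\<sigma> (OMap K b)) (ap (\<eta> b) x))"
        have "nat_trans B (SET \<kappa>) G (H \<circ>\<^sub>F K) ?\<beta>"
        proof (rule nat_trans_set_trans[OF G HK])
          show "ap (\<sigma> (OMap K b)) (ap (\<eta> b) x) \<in> OMap (H \<circ>\<^sub>F K) b"
            if "b \<in> Obj B" "x \<in> OMap G b" for b x
            using ap_in[OF \<sigma>_in ap_in[OF \<eta>_in]] that by simp
          fix f b b' x assume f: "f \<in> Hom B b b'" and x: "x \<in> OMap G b"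
          then have b: "b \<in> Obj B" using D.cod.Hom_Obj by blast
          show "ap (\<sigma> (OMap K b')) (ap (\<eta> b') (ap (AMap G f) x)) =
              ap (AMap (H \<circ>\<^sub>F K) f) (ap (\<sigma> (OMap K b)) (ap (\<eta> b) x))"
            using nat_trans_ap_natural[OF \<eta> f x]
              nat_trans_ap_natural[OF \<sigma> K.amap_in[OF f] ap_in[OF \<eta>_in[OF b] x]] by simp
        qed
        moreover have "ap (?\<beta> (OMap D j)) (e j) = a j" if "j \<in> Obj J" for j
          using eq that e_in[OF that] D.omap_in[OF that] by simp
        ultimately have \<beta>: "?\<beta> = \<alpha>" using ex1 \<alpha> \<alpha>e by blast
        show "\<forall>b \<in> Obj B. Comp (SET \<kappa>) (\<sigma> (OMap K b)) (\<eta> b) = \<alpha> b"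
        proof
          fix b assume b: "b \<in> Obj B"
          show "Comp (SET \<kappa>) (\<sigma> (OMap K b)) (\<eta> b) = \<alpha> b"
          proof (rule SET_arr_eqI[OF S.comp_in[OF \<eta>_in[OF b] \<sigma>_in[OF b]] \<alpha>_in[OF b]])
            fix x assume x: "x \<in> OMap G b"
            have "ap (?\<beta> b) x = ap (\<sigma> (OMap K b)) (ap (\<eta> b) x)" using b x by simp
            then show "ap (Comp (SET \<kappa>) (\<sigma> (OMap K b)) (\<eta> b)) x = ap (\<alpha> b) x"
              using ap_Comp[OF \<eta>_in[OF b] \<sigma>_in[OF b] x] \<beta> by simp
          qed
        qed
      qed
    qed
    then have "(\<lambda>\<sigma>. nat_trans C (SET \<kappa>) F H \<sigma> \<and>
          (\<forall>j \<in> Obj J. ap (\<sigma> (OMap (K \<circ>\<^sub>F D) j)) (?e j) = a j)) =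
        (\<lambda>\<sigma>. nat_trans C (SET \<kappa>) F H \<sigma> \<and> (\<forall>b \<in> Obj B. Comp (SET \<kappa>) (\<sigma> (OMap K b)) (\<eta> b) = \<alpha> b))"
      by (intro ext) blast
    moreover have "\<exists>!\<sigma>. nat_trans C (SET \<kappa>) F H \<sigma> \<and>
        (\<forall>b \<in> Obj B. Comp (SET \<kappa>) (\<sigma> (OMap K b)) (\<eta> b) = \<alpha> b)"
      using kan H \<alpha> by (simp add: is_left_kan_extension_def)
    ultimately show ?thesis by simp
  qed
  then show ?thesis
    using is_functor_comp[OF D K] F e' by (simp add: freely_generated_def)
qed

lemma full_subcategory_simps [simp]:
  "Obj (full_subcategory C S) = S" "Id (full_subcategory C S) = Id C"
  "Comp (full_subcategory C S) = Comp C"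
  by (simp_all add: full_subcategory_def)

lemma Hom_full_subcategory:
  "f \<in> Hom (full_subcategory C S) x y \<longleftrightarrow> f \<in> Hom C x y \<and> x \<in> S \<and> y \<in> S"
  by (auto simp: full_subcategory_def Hom_def)

lemma inclusion_simps [simp]: "OMap inclusion x = x" "AMap inclusion f = f"
  by (simp_all add: inclusion_def)

lemma (in category) is_functor_inclusion:
  assumes "S \<subseteq> Obj C"
  shows "is_functor (full_subcategory C S) C inclusion"
proof -
  have "category (full_subcategory C S)"
  proof
    fix f assume "f \<in> Arr (full_subcategory C S)"
    then show "Dom (full_subcategory C S) f \<in> Obj (full_subcategory C S)"
        "Cod (full_subcategory C S) f \<in> Obj (full_subcategory C S)"
      by (simp_all add: full_subcategory_def)
  qed (use assms id_in comp_in id_left id_right comp_assoc in \<open>auto simp: Hom_full_subcategory\<close>)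
  then show ?thesis
    using assms category_axioms
    by (auto simp: is_functor_def is_functor_axioms_def Hom_full_subcategory)
qed

context locally_small_category
begin

lemma small_full_subcategory:
  assumes S: "S \<subseteq> Obj C" and "small \<kappa> S"
  shows "small_category \<kappa> (full_subcategory C S)"
proof -
  have "small \<kappa> (snd ` (SIGMA p : S \<times> S. Hom C (fst p) (snd p)))"
    using assms by (intro small_image small_Sigma universe small_Hom)
  moreover have "Arr (full_subcategory C S) \<subseteq> snd ` (SIGMA p : S \<times> S. Hom C (fst p) (snd p))"
    by (force simp: full_subcategory_def Hom_def image_iff)
  ultimately have "small \<kappa> (Arr (full_subcategory C S))" by (rule small_subset)
  moreover have "category (full_subcategory C S)"
    using is_functor_inclusion[OF S] by (simp add: is_functor_def)
  ultimately show ?thesis using assms by (simp add: small_category_def)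
qed

text \<open>
  A transformation \<open>\<alpha> : F|S \<Rightarrow> H|S\<close> moves \<open>e\<close> to a compatible family, and so gives a unique
  \<open>\<sigma> : F \<Rightarrow> H\<close> that agrees with \<open>\<alpha>\<close> on \<open>e\<close>.  At an object \<open>s\<close> of \<open>S\<close>, the elements \<open>F k (e j)\<close> with
  \<open>k : D j \<rightarrow> s\<close> separate maps out of \<open>F s\<close>, and fullness makes \<open>\<alpha>\<close> natural along every such \<open>k\<close>;
  hence \<open>\<sigma> s = \<alpha> s\<close>.
\<close>

theorem left_kan_extension_of_restriction:
  assumes free: "freely_generated \<kappa> J C D F e" and S: "S \<subseteq> Obj C" and DS: "OMap D ` Obj J \<subseteq> S"
  shows "is_left_kan_extension (full_subcategory C S) C (SET \<kappa>) inclusion (F \<circ>\<^sub>F inclusion) F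
    (id_trans (full_subcategory C S) (SET \<kappa>) (F \<circ>\<^sub>F inclusion))"
proof -
  have D: "is_functor J C D" and F: "is_functor C (SET \<kappa>) F" and e: "limit_element J (F \<circ>\<^sub>F D) e"
    using free by (auto simp: freely_generated_def)
  let ?B = "full_subcategory C S"
  let ?\<eta> = "id_trans ?B (SET \<kappa>) (F \<circ>\<^sub>F inclusion)"
  interpret D: is_functor J C D by fact
  interpret F: set_functor \<kappa> C F using F by simp
  have inc: "is_functor ?B C inclusion" by (rule is_functor_inclusion[OF S])
  have Fi: "is_functor ?B (SET \<kappa>) (F \<circ>\<^sub>F inclusion)" by (rule is_functor_comp[OF inc F])
  have sm: "OMap F s \<in> Obj (SET \<kappa>)" if "s \<in> S" for s using F.small_value S that by auto
  have e_in: "e j \<in> OMap F (OMap D j)" if "j \<in> Obj J" for j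
    using limit_elementD(1)[OF e that] by simp
  have \<eta>: "nat_trans ?B (SET \<kappa>) (F \<circ>\<^sub>F inclusion) (F \<circ>\<^sub>F inclusion) ?\<eta>"
  proof (rule set_nat_transI[OF Fi Fi])
    show "?\<eta> s \<in> Hom (SET \<kappa>) (OMap (F \<circ>\<^sub>F inclusion) s) (OMap (F \<circ>\<^sub>F inclusion) s)"
      if "s \<in> Obj ?B" for s
      using that F.cod.id_in[OF sm] by (simp add: id_trans_def)
    fix f s t x assume "f \<in> Hom ?B s t" "x \<in> OMap (F \<circ>\<^sub>F inclusion) s"
    then show "ap (?\<eta> t) (ap (AMap (F \<circ>\<^sub>F inclusion) f) x) = ap (AMap (F \<circ>\<^sub>F inclusion) f) (ap (?\<eta> s) x)"
      using F.act_in by (auto simp: id_trans_def Hom_full_subcategory)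
  qed (simp add: id_trans_def)
  have "\<exists>!\<sigma>. nat_trans C (SET \<kappa>) F H \<sigma> \<and>
      (\<forall>s \<in> Obj ?B. Comp (SET \<kappa>) (\<sigma> (OMap inclusion s)) (?\<eta> s) = \<alpha> s)"
    if H: "is_functor C (SET \<kappa>) H" and \<alpha>: "nat_trans ?B (SET \<kappa>) (F \<circ>\<^sub>F inclusion) (H \<circ>\<^sub>F inclusion) \<alpha>"
    for H \<alpha>
  proof -
    interpret H: set_functor \<kappa> C H using H by simp
    define a where "a j = ap (\<alpha> (OMap D j)) (e j)" for j
    have \<alpha>_in: "\<alpha> s \<in> Hom (SET \<kappa>) (OMap F s) (OMap H s)" if "s \<in> S" for s
      using nat_trans.component_in[OF \<alpha>] that by simp
    have \<alpha>_nat: "ap (\<alpha> t) (ap (AMap F f) x) = ap (AMap H f) (ap (\<alpha> s) x)"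
      if "f \<in> Hom C s t" "s \<in> S" "t \<in> S" "x \<in> OMap F s" for f s t x
      using nat_trans_ap_natural[OF \<alpha>, of f s t x] that by (simp add: Hom_full_subcategory)
    have DS': "OMap D j \<in> S" if "j \<in> Obj J" for j using DS that by blast
    have a: "limit_element J (H \<circ>\<^sub>F D) a"
      unfolding limit_element_def
    proof (intro conjI ballI allI)
      show "a j \<in> OMap (H \<circ>\<^sub>F D) j" if "j \<in> Obj J" for j
        using ap_in[OF \<alpha>_in[OF DS'[OF that]] e_in[OF that]] by (simp add: a_def)
      fix i j \<phi> assume \<phi>: "\<phi> \<in> Hom J i j"
      then have ij: "i \<in> Obj J" "j \<in> Obj J" using D.dom.Hom_Obj by blast+
      show "ap (AMap (H \<circ>\<^sub>F D) \<phi>) (a i) = a j"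
        using \<alpha>_nat[OF D.amap_in[OF \<phi>] DS'[OF ij(1)] DS'[OF ij(2)] e_in[OF ij(1)]]
          limit_elementD(2)[OF e \<phi>] by (simp add: a_def)
    qed
    have "(\<forall>s \<in> Obj ?B. Comp (SET \<kappa>) (\<sigma> (OMap inclusion s)) (?\<eta> s) = \<alpha> s) \<longleftrightarrow>
        (\<forall>j \<in> Obj J. ap (\<sigma> (OMap D j)) (e j) = a j)"
      if \<sigma>: "nat_trans C (SET \<kappa>) F H \<sigma>" for \<sigma>
    proof -
      have \<sigma>_in: "\<sigma> s \<in> Hom (SET \<kappa>) (OMap F s) (OMap H s)" if "s \<in> S" for s
        using nat_trans.component_in[OF \<sigma>] S that by blast
      have "Comp (SET \<kappa>) (\<sigma> (OMap inclusion s)) (?\<eta> s) = \<sigma> s" if "s \<in> S" for s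
        using F.cod.id_right[OF \<sigma>_in[OF that]] that by (simp add: id_trans_def)
      then have "(\<forall>s \<in> Obj ?B. Comp (SET \<kappa>) (\<sigma> (OMap inclusion s)) (?\<eta> s) = \<alpha> s) \<longleftrightarrow>
          (\<forall>s \<in> S. \<sigma> s = \<alpha> s)"
        by simp
      also have "\<dots> \<longleftrightarrow> (\<forall>j \<in> Obj J. ap (\<sigma> (OMap D j)) (e j) = a j)"
      proof
        assume "\<forall>s \<in> S. \<sigma> s = \<alpha> s"
        then show "\<forall>j \<in> Obj J. ap (\<sigma> (OMap D j)) (e j) = a j" using DS' by (simp add: a_def)
      next
        assume eq: "\<forall>j \<in> Obj J. ap (\<sigma> (OMap D j)) (e j) = a j"
        show "\<forall>s \<in> S. \<sigma> s = \<alpha> s"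
        proof
          fix s assume s: "s \<in> S"
          then have sC: "s \<in> Obj C" using S by blast
          show "\<sigma> s = \<alpha> s"
          proof (rule SET_arr_eqI[OF \<sigma>_in[OF s] \<alpha>_in[OF s]])
            fix x assume x: "x \<in> OMap F s"
            show "ap (\<sigma> s) x = ap (\<alpha> s) x"
            proof (rule universal_hom_cocone_unique[OF freely_generated_imp_pointwise[OF free sC]
                  H.small_value[OF sC] hom_cocone_act[OF D H a] _ _ _ _ x])
              fix j k assume j: "j \<in> Obj J" and k: "k \<in> Hom C (OMap D j) s"
              show "ap (\<sigma> s) (ap (AMap F k) (e j)) = ap (AMap H k) (a j)"
                using nat_trans_ap_natural[OF \<sigma> k e_in[OF j]] eq j by simp
              show "ap (\<alpha> s) (ap (AMap F k) (e j)) = ap (AMap H k) (a j)"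
                using \<alpha>_nat[OF k DS'[OF j] s e_in[OF j]] by (simp add: a_def)
            qed (use ap_in[OF \<sigma>_in[OF s]] ap_in[OF \<alpha>_in[OF s]] in blast)+
          qed
        qed
      qed
      finally show ?thesis .
    qed
    then have "(\<lambda>\<sigma>. nat_trans C (SET \<kappa>) F H \<sigma> \<and>
          (\<forall>s \<in> Obj ?B. Comp (SET \<kappa>) (\<sigma> (OMap inclusion s)) (?\<eta> s) = \<alpha> s)) =
        (\<lambda>\<sigma>. nat_trans C (SET \<kappa>) F H \<sigma> \<and> (\<forall>j \<in> Obj J. ap (\<sigma> (OMap D j)) (e j) = a j))"
      by (intro ext) blast
    moreover have "\<exists>!\<sigma>. nat_trans C (SET \<kappa>) F H \<sigma> \<and> (\<forall>j \<in> Obj J. ap (\<sigma> (OMap D j)) (e j) = a j)"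
      using free H a by (simp add: freely_generated_def)
    ultimately show ?thesis by simp
  qed
  then show ?thesis using inc F \<eta> by (simp add: is_left_kan_extension_def)
qed

end


section \<open>The category of elements\<close>

text \<open>
  An arrow \<open>(x, a) \<rightarrow> (y, b)\<close> is an arrow \<open>f : x \<rightarrow> y\<close> with \<open>F f a = b\<close>; it is stored with its source
  element, from which \<open>b\<close> is recovered.
\<close>

definition elements ::
  "('o, 'a) cat \<Rightarrow> ('o, 'a, 'u set, 'u set_arr) func \<Rightarrow> ('o \<times> 'u, 'a \<times> 'u) cat" where
  "elements C F =
     \<lparr>Obj = (SIGMA x : Obj C. OMap F x), Arr = (SIGMA f : Arr C. OMap F (Dom C f)),
      Dom = (\<lambda>(f, a). (Dom C f, a)), Cod = (\<lambda>(f, a). (Cod C f, ap (AMap F f) a)),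
      Id = (\<lambda>(x, a). (Id C x, a)), Comp = (\<lambda>(g, _) (f, a). (Comp C g f, a))\<rparr>"

definition elements_proj :: "('o \<times> 'u, 'a \<times> 'u, 'o, 'a) func" where
  "elements_proj = \<lparr>OMap = fst, AMap = fst\<rparr>"

lemma Hom_elements:
  "\<phi> \<in> Hom (elements C F) p q \<longleftrightarrow> (\<exists>f. \<phi> = (f, snd p) \<and> f \<in> Hom C (fst p) (fst q) \<and>
     snd p \<in> OMap F (fst p) \<and> snd q = ap (AMap F f) (snd p))"
  by (cases \<phi>; cases p; cases q) (auto simp: elements_def Hom_def)

context set_functor
begin

lemma is_functor_elements_proj: "is_functor (elements C F) C elements_proj"
proof -
  have "category (elements C F)"
  proof
    fix \<phi> assume "\<phi> \<in> Arr (elements C F)"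
    then show "Dom (elements C F) \<phi> \<in> Obj (elements C F)" "Cod (elements C F) \<phi> \<in> Obj (elements C F)"
      using dom.dom_in dom.cod_in act_in by (auto simp: elements_def in_Hom)
  next
    fix p assume "p \<in> Obj (elements C F)"
    then show "Id (elements C F) p \<in> Hom (elements C F) p p"
      unfolding Hom_elements using dom.id_in act_id by (auto simp: elements_def)
  next
    fix \<phi> \<psi> p q r assume "\<phi> \<in> Hom (elements C F) p q" "\<psi> \<in> Hom (elements C F) q r"
    then show "Comp (elements C F) \<psi> \<phi> \<in> Hom (elements C F) p r"
      unfolding Hom_elements using dom.comp_in act_comp by (auto simp: elements_def)
  next
    fix \<phi> p q assume "\<phi> \<in> Hom (elements C F) p q"
    then show "Comp (elements C F) \<phi> (Id (elements C F) p) = \<phi>"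
        "Comp (elements C F) (Id (elements C F) q) \<phi> = \<phi>"
      unfolding Hom_elements using dom.id_left dom.id_right by (auto simp: elements_def split: prod.splits)
  next
    fix \<phi> \<psi> \<chi> p q r s
    assume "\<phi> \<in> Hom (elements C F) p q" "\<psi> \<in> Hom (elements C F) q r" "\<chi> \<in> Hom (elements C F) r s"
    then show "Comp (elements C F) \<chi> (Comp (elements C F) \<psi> \<phi>) =
        Comp (elements C F) (Comp (elements C F) \<chi> \<psi>) \<phi>"
      unfolding Hom_elements using dom.comp_assoc by (auto simp: elements_def)
  qed
  moreover have "is_functor_axioms (elements C F) C elements_proj"
    unfolding is_functor_axioms_def Hom_elements by (auto simp: elements_proj_def elements_def)
  ultimately show ?thesis using dom.category_axioms by (simp add: is_functor_def)
qed

text \<open>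
  The density theorem.  A compatible family over the category of elements chooses an element of
  \<open>H x\<close> for each \<open>a \<in> F x\<close>, and its compatibility is naturality of this choice.
\<close>

theorem freely_generated_elements: "freely_generated \<kappa> (elements C F) C elements_proj F snd"
proof -
  have F: "is_functor C (SET \<kappa>) F" by unfold_locales
  have "limit_element (elements C F) (F \<circ>\<^sub>F elements_proj) snd"
    by (auto simp: limit_element_def Hom_elements elements_proj_def) (auto simp: elements_def)
  moreover have "\<exists>!\<sigma>. nat_trans C (SET \<kappa>) F H \<sigma> \<and>
      (\<forall>p \<in> Obj (elements C F). ap (\<sigma> (OMap elements_proj p)) (snd p) = a p)"
    if H: "is_functor C (SET \<kappa>) H" and a: "limit_element (elements C F) (H \<circ>\<^sub>F elements_proj) a" for H a
  proof (rule ex1I)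
    have a_in: "a (x, y) \<in> OMap H x" if "x \<in> Obj C" "y \<in> OMap F x" for x y
      using limit_elementD(1)[OF a, of "(x, y)"] that by (simp add: elements_def elements_proj_def)
    have a_nat: "a (x', ap (AMap F f) y) = ap (AMap H f) (a (x, y))"
      if "f \<in> Hom C x x'" "y \<in> OMap F x" for f x x' y
      using limit_elementD(2)[OF a, of "(f, y)" "(x, y)" "(x', ap (AMap F f) y)"] that
      by (simp add: Hom_elements elements_proj_def)
    let ?\<sigma> = "set_trans C F H (\<lambda>x y. a (x, y))"
    have \<sigma>: "nat_trans C (SET \<kappa>) F H ?\<sigma>"
      by (rule nat_trans_set_trans[OF F H]) (simp_all add: a_in a_nat)
    then show "nat_trans C (SET \<kappa>) F H ?\<sigma> \<and>
        (\<forall>p \<in> Obj (elements C F). ap (?\<sigma> (OMap elements_proj p)) (snd p) = a p)"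
      by (auto simp: elements_def elements_proj_def)
    fix \<tau> assume \<tau>: "nat_trans C (SET \<kappa>) F H \<tau> \<and>
        (\<forall>p \<in> Obj (elements C F). ap (\<tau> (OMap elements_proj p)) (snd p) = a p)"
    show "\<tau> = ?\<sigma>"
    proof (rule nat_trans_eqI[OF conjunct1[OF \<tau>] \<sigma>])
      fix x y assume "x \<in> Obj C" "y \<in> OMap F x"
      then show "ap (\<tau> x) y = ap (?\<sigma> x) y"
        using bspec[OF conjunct2[OF \<tau>], of "(x, y)"] by (simp add: elements_def elements_proj_def)
    qed
  qed
  ultimately show ?thesis
    using is_functor_elements_proj F unfolding freely_generated_def by blast
qed

lemma small_elements:
  assumes "universe_cardinal \<kappa>" and "small_category \<kappa> C"
  shows "small_category \<kappa> (elements C F)"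
proof -
  have "small \<kappa> (Sigma (Obj C) (OMap F))" "small \<kappa> (SIGMA f : Arr C. OMap F (Dom C f))"
    using assms dom.dom_in small_value by (auto simp: small_category_def intro!: small_Sigma)
  then show ?thesis
    using is_functor_elements_proj by (simp add: small_category_def elements_def is_functor_def)
qed

end


section \<open>Invariance under isomorphism of the indexing category\<close>

text \<open>
  The equations are restricted to objects and arrows, since the functions that make up a functor are
  arbitrary elsewhere.
\<close>

definition mutually_inverse :: "('i, 'm) cat \<Rightarrow> ('j, 'n) cat \<Rightarrow> ('i, 'm, 'j, 'n) func \<Rightarrow>
    ('j, 'n, 'i, 'm) func \<Rightarrow> bool" where
  "mutually_inverse A B \<Phi> \<Psi> \<longleftrightarrow>
     is_functor A B \<Phi> \<and> is_functor B A \<Psi> \<and>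
     (\<forall>x \<in> Obj A. OMap \<Psi> (OMap \<Phi> x) = x) \<and> (\<forall>f \<in> Arr A. AMap \<Psi> (AMap \<Phi> f) = f) \<and>
     (\<forall>y \<in> Obj B. OMap \<Phi> (OMap \<Psi> y) = y) \<and> (\<forall>g \<in> Arr B. AMap \<Phi> (AMap \<Psi> g) = g)"

definition relabel :: "('o \<Rightarrow> 'p) \<Rightarrow> ('a \<Rightarrow> 'q) \<Rightarrow> ('o, 'a) cat \<Rightarrow> ('p, 'q) cat" where
  "relabel p q C = (let p' = inv_into (Obj C) p; q' = inv_into (Arr C) q in
     \<lparr>Obj = p ` Obj C, Arr = q ` Arr C, Dom = p \<circ> Dom C \<circ> q', Cod = p \<circ> Cod C \<circ> q',
      Id = q \<circ> Id C \<circ> p', Comp = (\<lambda>g f. q (Comp C (q' g) (q' f)))\<rparr>)"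

lemma (in category) mutually_inverse_relabel:
  assumes p: "inj_on p (Obj C)" and q: "inj_on q (Arr C)"
  shows "mutually_inverse (relabel p q C) C
    \<lparr>OMap = inv_into (Obj C) p, AMap = inv_into (Arr C) q\<rparr> \<lparr>OMap = p, AMap = q\<rparr>"
proof -
  let ?R = "relabel p q C"
  have p': "inv_into (Obj C) p (p x) = x" if "x \<in> Obj C" for x using inv_into_f_f[OF p that] .
  have q': "inv_into (Arr C) q (q f) = f" if "f \<in> Arr C" for f using inv_into_f_f[OF q that] .
  have Arr: "f \<in> Arr C" if "f \<in> Hom C x y" for f x y using that by (simp add: in_Hom)
  have sel: "Obj ?R = p ` Obj C" "Arr ?R = q ` Arr C"
    by (simp_all add: relabel_def Let_def)
  have Id: "Id ?R (p x) = q (Id C x)" if "x \<in> Obj C" for x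
    using that by (simp add: relabel_def Let_def p')
  have Comp: "Comp ?R (q g) (q f) = q (Comp C g f)" if "f \<in> Arr C" "g \<in> Arr C" for f g
    using that by (simp add: relabel_def Let_def q')
  have DC: "Dom ?R (q f) = p (Dom C f)" "Cod ?R (q f) = p (Cod C f)" if "f \<in> Arr C" for f
    using that by (simp_all add: relabel_def Let_def q')
  have Hom: "q f \<in> Hom ?R (p x) (p y)" if "f \<in> Hom C x y" for f x y
    using that DC by (simp add: in_Hom sel)
  have HomE: "\<exists>f x y. f \<in> Hom C x y \<and> g = q f \<and> u = p x \<and> v = p y" if "g \<in> Hom ?R u v" for g u v
    using that DC by (auto simp: in_Hom sel)
  have p_eq: "x = y" if "p x = p y" "x \<in> Obj C" "y \<in> Obj C" for x y using p that by (meson inj_onD)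
  have R: "category ?R"
  proof
    fix f assume "f \<in> Arr ?R"
    then show "Dom ?R f \<in> Obj ?R" "Cod ?R f \<in> Obj ?R" using dom_in cod_in DC by (auto simp: sel)
  next
    fix x assume "x \<in> Obj ?R"
    then show "Id ?R x \<in> Hom ?R x x" using Hom[OF id_in] Id by (auto simp: sel)
  next
    fix f g u v w assume "f \<in> Hom ?R u v" "g \<in> Hom ?R v w"
    then obtain f' x y g' y' z where f: "f' \<in> Hom C x y" "f = q f'" "u = p x" "v = p y"
        and g: "g' \<in> Hom C y' z" "g = q g'" "v = p y'" "w = p z"
      using HomE by metis
    have "y' = y" using p_eq f(4) g(3) Hom_Obj[OF f(1)] Hom_Obj[OF g(1)] by simp
    then show "Comp ?R g f \<in> Hom ?R u w"
      using Hom[OF comp_in] Comp[OF Arr Arr] f g by metis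
  next
    fix f u v assume "f \<in> Hom ?R u v"
    then obtain f' x y where f: "f' \<in> Hom C x y" "f = q f'" "u = p x" "v = p y" using HomE by metis
    have xy: "x \<in> Obj C" "y \<in> Obj C" using Hom_Obj[OF f(1)] by auto
    show "Comp ?R f (Id ?R u) = f" "Comp ?R (Id ?R v) f = f"
      using f xy Id Comp[OF Arr[OF id_in] Arr] Comp[OF Arr Arr[OF id_in]] id_left id_right by simp_all
  next
    fix f g h t u v w assume "f \<in> Hom ?R t u" "g \<in> Hom ?R u v" "h \<in> Hom ?R v w"
    then obtain f' x y g' y' z h' z' r where f: "f' \<in> Hom C x y" "f = q f'" "u = p y"
        and g: "g' \<in> Hom C y' z" "g = q g'" "u = p y'" "v = p z"
        and h: "h' \<in> Hom C z' r" "h = q h'" "v = p z'"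
      using HomE by metis
    have "y' = y" "z' = z"
      using p_eq f(3) g(3,4) h(3) Hom_Obj[OF f(1)] Hom_Obj[OF g(1)] Hom_Obj[OF h(1)] by simp_all
    then have g1: "g' \<in> Hom C y z" and h1: "h' \<in> Hom C z r" using g(1) h(1) by simp_all
    show "Comp ?R h (Comp ?R g f) = Comp ?R (Comp ?R h g) f"
      using comp_assoc[OF f(1) g1 h1] Arr[OF f(1)] Arr[OF g1] Arr[OF h1]
        Arr[OF comp_in[OF f(1) g1]] Arr[OF comp_in[OF g1 h1]]
      by (simp add: f(2) g(2) h(2) Comp)
  qed
  have "is_functor ?R C \<lparr>OMap = inv_into (Obj C) p, AMap = inv_into (Arr C) q\<rparr>"
    unfolding is_functor_def is_functor_axioms_def
  proof (intro conjI allI impI)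
    fix x assume "x \<in> Obj ?R"
    then show "OMap \<lparr>OMap = inv_into (Obj C) p, AMap = inv_into (Arr C) q\<rparr> x \<in> Obj C"
      by (auto simp: sel p')
  next
    fix f u v assume "f \<in> Hom ?R u v"
    then obtain f' x y where f: "f' \<in> Hom C x y" "f = q f'" "u = p x" "v = p y" using HomE by metis
    then show "AMap \<lparr>OMap = inv_into (Obj C) p, AMap = inv_into (Arr C) q\<rparr> f \<in>
        Hom C (OMap \<lparr>OMap = inv_into (Obj C) p, AMap = inv_into (Arr C) q\<rparr> u)
          (OMap \<lparr>OMap = inv_into (Obj C) p, AMap = inv_into (Arr C) q\<rparr> v)"
      using Hom_Obj[OF f(1)] Arr by (simp add: p' q')
  next
    fix x assume "x \<in> Obj ?R"
    then show "AMap \<lparr>OMap = inv_into (Obj C) p, AMap = inv_into (Arr C) q\<rparr> (Id ?R x) =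
        Id C (OMap \<lparr>OMap = inv_into (Obj C) p, AMap = inv_into (Arr C) q\<rparr> x)"
      using Id Arr[OF id_in] by (auto simp: sel p' q')
  next
    fix f g u v w assume "f \<in> Hom ?R u v" "g \<in> Hom ?R v w"
    then obtain f' x y g' y' z where f: "f' \<in> Hom C x y" "f = q f'" "v = p y"
        and g: "g' \<in> Hom C y' z" "g = q g'" "v = p y'"
      using HomE by metis
    have "y' = y" using p_eq f(3) g(3) Hom_Obj[OF f(1)] Hom_Obj[OF g(1)] by simp
    then show "AMap \<lparr>OMap = inv_into (Obj C) p, AMap = inv_into (Arr C) q\<rparr> (Comp ?R g f) =
        Comp C (AMap \<lparr>OMap = inv_into (Obj C) p, AMap = inv_into (Arr C) q\<rparr> g)
          (AMap \<lparr>OMap = inv_into (Obj C) p, AMap = inv_into (Arr C) q\<rparr> f)"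
      using f g Arr Comp Arr[OF comp_in[OF f(1)]] by (simp add: q')
  qed (use R category_axioms in auto)
  moreover have "is_functor C ?R \<lparr>OMap = p, AMap = q\<rparr>"
    unfolding is_functor_def is_functor_axioms_def
    using R category_axioms Hom Id Comp[OF Arr Arr] by (auto simp: sel)
  ultimately show ?thesis
    by (auto simp: mutually_inverse_def sel p' q')
qed

text \<open>
  Small categories do not depend on the types that carry them, as long as these are large enough.
\<close>

lemma ex_relabelling:
  fixes C :: "('o, 'a) cat"
  assumes C: "small_category \<kappa> C"
    and "\<kappa> \<le>o |UNIV :: 'p set|" and "\<kappa> \<le>o |UNIV :: 'q set|"
  shows "\<exists>(B :: ('p, 'q) cat) \<Phi> \<Psi>. small_category \<kappa> B \<and> mutually_inverse B C \<Phi> \<Psi>"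
proof -
  interpret category C using C by (simp add: small_category_def)
  obtain p :: "'o \<Rightarrow> 'p" and q :: "'a \<Rightarrow> 'q" where p: "inj_on p (Obj C)" and q: "inj_on q (Arr C)"
    using C small_embeds assms(2,3) unfolding small_category_def by metis
  note inv = mutually_inverse_relabel[OF p q]
  have "small_category \<kappa> (relabel p q C)"
    using C inv small_image[of \<kappa> "Obj C" p] small_image[of \<kappa> "Arr C" q]
    by (auto simp: small_category_def mutually_inverse_def is_functor_def relabel_def Let_def)
  then show ?thesis using inv by blast
qed

lemma freely_generated_reindex:
  assumes free: "freely_generated \<kappa> J C D F e" and iso: "mutually_inverse I J \<Phi> \<Psi>"
  shows "freely_generated \<kappa> I C (D \<circ>\<^sub>F \<Phi>) F (\<lambda>i. e (OMap \<Phi> i))"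
proof -
  have D: "is_functor J C D" and F: "is_functor C (SET \<kappa>) F" and e: "limit_element J (F \<circ>\<^sub>F D) e"
    using free by (auto simp: freely_generated_def)
  have \<Phi>: "is_functor I J \<Phi>" and \<Psi>: "is_functor J I \<Psi>"
    and inv: "\<And>i. i \<in> Obj I \<Longrightarrow> OMap \<Psi> (OMap \<Phi> i) = i" "\<And>j. j \<in> Obj J \<Longrightarrow> OMap \<Phi> (OMap \<Psi> j) = j"
      "\<And>f. f \<in> Arr J \<Longrightarrow> AMap \<Phi> (AMap \<Psi> f) = f"
    using iso by (auto simp: mutually_inverse_def)
  interpret \<Phi>: is_functor I J \<Phi> by fact
  interpret \<Psi>: is_functor J I \<Psi> by fact
  have "limit_element I (F \<circ>\<^sub>F (D \<circ>\<^sub>F \<Phi>)) (\<lambda>i. e (OMap \<Phi> i))"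
    using limit_elementD[OF e] \<Phi>.omap_in \<Phi>.amap_in unfolding limit_element_def by fastforce
  moreover have "\<exists>!\<sigma>. nat_trans C (SET \<kappa>) F H \<sigma> \<and>
      (\<forall>i \<in> Obj I. ap (\<sigma> (OMap (D \<circ>\<^sub>F \<Phi>) i)) (e (OMap \<Phi> i)) = a i)"
    if H: "is_functor C (SET \<kappa>) H" and a: "limit_element I (H \<circ>\<^sub>F (D \<circ>\<^sub>F \<Phi>)) a" for H a
  proof -
    have a': "limit_element J (H \<circ>\<^sub>F D) (\<lambda>j. a (OMap \<Psi> j))"
      unfolding limit_element_def
    proof (intro conjI ballI allI)
      show "a (OMap \<Psi> j) \<in> OMap (H \<circ>\<^sub>F D) j" if "j \<in> Obj J" for j
        using limit_elementD(1)[OF a \<Psi>.omap_in[OF that]] inv(2)[OF that] by simp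
      show "ap (AMap (H \<circ>\<^sub>F D) \<phi>) (a (OMap \<Psi> j)) = a (OMap \<Psi> j')" if \<phi>: "\<phi> \<in> Hom J j j'" for \<phi> j j'
        using limit_elementD(2)[OF a \<Psi>.amap_in[OF \<phi>]] inv(3)[of \<phi>] \<phi> by (simp add: in_Hom)
    qed
    have "(\<forall>i \<in> Obj I. ap (\<sigma> (OMap (D \<circ>\<^sub>F \<Phi>) i)) (e (OMap \<Phi> i)) = a i) \<longleftrightarrow>
        (\<forall>j \<in> Obj J. ap (\<sigma> (OMap D j)) (e j) = a (OMap \<Psi> j))" for \<sigma>
    proof
      assume l: "\<forall>i \<in> Obj I. ap (\<sigma> (OMap (D \<circ>\<^sub>F \<Phi>) i)) (e (OMap \<Phi> i)) = a i"
      show "\<forall>j \<in> Obj J. ap (\<sigma> (OMap D j)) (e j) = a (OMap \<Psi> j)"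
      proof
        fix j assume j: "j \<in> Obj J"
        show "ap (\<sigma> (OMap D j)) (e j) = a (OMap \<Psi> j)"
          using bspec[OF l \<Psi>.omap_in[OF j]] inv(2)[OF j] by simp
      qed
    next
      assume r: "\<forall>j \<in> Obj J. ap (\<sigma> (OMap D j)) (e j) = a (OMap \<Psi> j)"
      show "\<forall>i \<in> Obj I. ap (\<sigma> (OMap (D \<circ>\<^sub>F \<Phi>) i)) (e (OMap \<Phi> i)) = a i"
        using r \<Phi>.omap_in inv(1) by simp
    qed
    moreover have "\<exists>!\<sigma>. nat_trans C (SET \<kappa>) F H \<sigma> \<and>
        (\<forall>j \<in> Obj J. ap (\<sigma> (OMap D j)) (e j) = a (OMap \<Psi> j))"
      using free H a' by (simp add: freely_generated_def)
    ultimately show ?thesis by simp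
  qed
  ultimately show ?thesis
    using is_functor_comp[OF \<Phi> D] F by (simp add: freely_generated_def)
qed

text \<open>
  Transformations over \<open>A\<close> are carried to \<open>B\<close> along \<open>\<Psi>\<close> componentwise.  Whiskering with \<open>\<Psi>\<close> would not
  do, because \<open>G \<circ> \<Phi> \<circ> \<Psi>\<close> equals \<open>G\<close> only on objects and arrows of \<open>B\<close>.
\<close>

lemma left_kan_extension_reindex:
  assumes kan: "is_left_kan_extension B C E K G F \<eta>" and iso: "mutually_inverse A B \<Phi> \<Psi>"
  shows "is_left_kan_extension A C E (K \<circ>\<^sub>F \<Phi>) (G \<circ>\<^sub>F \<Phi>) F (\<lambda>x \<in> Obj A. \<eta> (OMap \<Phi> x))"
proof -
  have K: "is_functor B C K" and \<eta>: "nat_trans B E G (F \<circ>\<^sub>F K) \<eta>" and F: "is_functor C E F"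
    using kan by (auto simp: is_left_kan_extension_def)
  have \<Phi>: "is_functor A B \<Phi>" and \<Psi>: "is_functor B A \<Psi>"
    and inv: "\<And>x. x \<in> Obj A \<Longrightarrow> OMap \<Psi> (OMap \<Phi> x) = x" "\<And>y. y \<in> Obj B \<Longrightarrow> OMap \<Phi> (OMap \<Psi> y) = y"
      "\<And>f. f \<in> Arr B \<Longrightarrow> AMap \<Phi> (AMap \<Psi> f) = f"
    using iso by (auto simp: mutually_inverse_def)
  have G: "is_functor B E G" using \<eta> by (simp add: nat_trans_def)
  interpret \<Phi>: is_functor A B \<Phi> by fact
  interpret \<Psi>: is_functor B A \<Psi> by fact
  interpret \<eta>: nat_trans B E G "F \<circ>\<^sub>F K" \<eta> by fact
  have K\<Phi>: "is_functor A C (K \<circ>\<^sub>F \<Phi>)" by (rule is_functor_comp[OF \<Phi> K])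
  have "nat_trans A E (G \<circ>\<^sub>F \<Phi>) (F \<circ>\<^sub>F (K \<circ>\<^sub>F \<Phi>)) (\<lambda>x \<in> Obj A. \<eta> (OMap \<Phi> x))"
  proof (intro nat_trans.intro nat_trans_axioms.intro)
    fix f x y assume f: "f \<in> Hom A x y"
    show "Comp E ((\<lambda>x \<in> Obj A. \<eta> (OMap \<Phi> x)) y) (AMap (G \<circ>\<^sub>F \<Phi>) f) =
        Comp E (AMap (F \<circ>\<^sub>F (K \<circ>\<^sub>F \<Phi>)) f) ((\<lambda>x \<in> Obj A. \<eta> (OMap \<Phi> x)) x)"
      using \<eta>.naturality[OF \<Phi>.amap_in[OF f]] \<Phi>.dom.Hom_Obj[OF f] by simp
  qed (use \<eta>.component_in[OF \<Phi>.omap_in] is_functor_comp[OF \<Phi> G] is_functor_comp[OF K\<Phi> F] in auto)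
  moreover have "\<exists>!\<sigma>. nat_trans C E F H \<sigma> \<and>
      (\<forall>x \<in> Obj A. Comp E (\<sigma> (OMap (K \<circ>\<^sub>F \<Phi>) x)) ((\<lambda>x \<in> Obj A. \<eta> (OMap \<Phi> x)) x) = \<alpha> x)"
    if H: "is_functor C E H" and \<alpha>: "nat_trans A E (G \<circ>\<^sub>F \<Phi>) (H \<circ>\<^sub>F (K \<circ>\<^sub>F \<Phi>)) \<alpha>" for H \<alpha>
  proof -
    interpret \<alpha>: nat_trans A E "G \<circ>\<^sub>F \<Phi>" "H \<circ>\<^sub>F (K \<circ>\<^sub>F \<Phi>)" \<alpha> by fact
    let ?\<alpha> = "\<lambda>y \<in> Obj B. \<alpha> (OMap \<Psi> y)"
    have \<alpha>': "nat_trans B E G (H \<circ>\<^sub>F K) ?\<alpha>"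
    proof (intro nat_trans.intro nat_trans_axioms.intro)
      fix y assume y: "y \<in> Obj B"
      show "?\<alpha> y \<in> Hom E (OMap G y) (OMap (H \<circ>\<^sub>F K) y)"
        using \<alpha>.component_in[OF \<Psi>.omap_in[OF y]] y inv(2)[OF y] by simp
    next
      fix f y z assume f: "f \<in> Hom B y z"
      then show "Comp E (?\<alpha> z) (AMap G f) = Comp E (AMap (H \<circ>\<^sub>F K) f) (?\<alpha> y)"
        using \<alpha>.naturality[OF \<Psi>.amap_in[OF f]] \<Phi>.cod.Hom_Obj[OF f] inv(3)[of f] by (simp add: in_Hom)
    qed (use G is_functor_comp[OF K H] in auto)
    have "(\<forall>x \<in> Obj A. Comp E (\<sigma> (OMap (K \<circ>\<^sub>F \<Phi>) x)) ((\<lambda>x \<in> Obj A. \<eta> (OMap \<Phi> x)) x) = \<alpha> x) \<longleftrightarrow>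
        (\<forall>y \<in> Obj B. Comp E (\<sigma> (OMap K y)) (\<eta> y) = ?\<alpha> y)" for \<sigma>
    proof
      assume l: "\<forall>x \<in> Obj A. Comp E (\<sigma> (OMap (K \<circ>\<^sub>F \<Phi>) x)) ((\<lambda>x \<in> Obj A. \<eta> (OMap \<Phi> x)) x) = \<alpha> x"
      show "\<forall>y \<in> Obj B. Comp E (\<sigma> (OMap K y)) (\<eta> y) = ?\<alpha> y"
      proof
        fix y assume y: "y \<in> Obj B"
        show "Comp E (\<sigma> (OMap K y)) (\<eta> y) = ?\<alpha> y"
          using bspec[OF l \<Psi>.omap_in[OF y]] \<Psi>.omap_in[OF y] y inv(2)[OF y] by simp
      qed
    next
      assume r: "\<forall>y \<in> Obj B. Comp E (\<sigma> (OMap K y)) (\<eta> y) = ?\<alpha> y"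
      show "\<forall>x \<in> Obj A. Comp E (\<sigma> (OMap (K \<circ>\<^sub>F \<Phi>) x)) ((\<lambda>x \<in> Obj A. \<eta> (OMap \<Phi> x)) x) = \<alpha> x"
        using r \<Phi>.omap_in inv(1) by simp
    qed
    moreover have "\<exists>!\<sigma>. nat_trans C E F H \<sigma> \<and>
        (\<forall>y \<in> Obj B. Comp E (\<sigma> (OMap K y)) (\<eta> y) = ?\<alpha> y)"
      using kan H \<alpha>' unfolding is_left_kan_extension_def by blast
    ultimately show ?thesis by simp
  qed
  ultimately show ?thesis
    using K\<Phi> F unfolding is_left_kan_extension_def by blast
qed


section \<open>Small functors are the left Kan extensions from small categories\<close>

lemma small_functor_on_small_category:
  fixes \<kappa> :: "'u rel"
  assumes universe: "universe_cardinal \<kappa>" and B: "small_category \<kappa> B" and G: "is_functor B (SET \<kappa>) G"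
  shows "locally_small \<kappa> B" and "small_functor \<kappa> B G"
proof -
  show ls: "locally_small \<kappa> B"
    unfolding locally_small_def
    using B by (auto simp: small_category_def in_Hom intro!: small_subset[of \<kappa> "Arr B"])
  interpret locally_small_category B \<kappa>
    using universe ls B
    by (simp add: locally_small_category_def locally_small_category_axioms_def small_category_def)
  interpret G: set_functor \<kappa> B G using G by simp
  note le = universe_le_UNIV[OF universe]
  obtain J :: "('u, 'u) cat" and \<Phi> \<Psi> where J: "small_category \<kappa> J"
    and iso: "mutually_inverse J (elements B G) \<Phi> \<Psi>"
    using ex_relabelling[OF G.small_elements[OF universe B] le le] by blast
  show "small_functor \<kappa> B G"
    using small_functor_iff_freely_generated[OF G] J
      freely_generated_reindex[OF G.freely_generated_elements iso] by blast
qed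

theorem theorem1p11:
  fixes \<kappa> :: "'u rel"
    and C :: "('o, 'a) cat"
    and F :: "('o, 'a, 'u set, 'u set_arr) func"
  assumes "universe_cardinal \<kappa>"
    and "\<kappa> \<le>o |UNIV :: 'p set|" and "\<kappa> \<le>o |UNIV :: 'q set|"
    and "category C" and "locally_small \<kappa> C"
    and "is_functor C (SET \<kappa>) F"
  shows
    "let
       a = (\<exists>S \<subseteq> Obj C. small_category \<kappa> (full_subcategory C S) \<and>
              is_left_kan_extension (full_subcategory C S) C (SET \<kappa>)
                inclusion (F \<circ>\<^sub>F inclusion) F
                (id_trans (full_subcategory C S) (SET \<kappa>) (F \<circ>\<^sub>F inclusion)));
       b = (\<exists>(B :: ('p, 'q) cat) K G \<eta>. small_category \<kappa> B \<and>
              is_left_kan_extension B C (SET \<kappa>) K G F \<eta>);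
       c = (\<exists>(B :: ('p, 'q) cat) K G \<eta>. category B \<and> locally_small \<kappa> B \<and>
              small_functor \<kappa> B G \<and>
              is_left_kan_extension B C (SET \<kappa>) K G F \<eta>);
       d = small_functor \<kappa> C F
     in (a \<longleftrightarrow> b) \<and> (b \<longleftrightarrow> c) \<and> (c \<longleftrightarrow> d)"
proof -
  interpret locally_small_category C \<kappa>
    using assms by (simp add: locally_small_category_def locally_small_category_axioms_def)
  define a where "a = (\<exists>S \<subseteq> Obj C. small_category \<kappa> (full_subcategory C S) \<and>
    is_left_kan_extension (full_subcategory C S) C (SET \<kappa>) inclusion (F \<circ>\<^sub>F inclusion) F
      (id_trans (full_subcategory C S) (SET \<kappa>) (F \<circ>\<^sub>F inclusion)))"
  define b where "b = (\<exists>(B :: ('p, 'q) cat) K G \<eta>. small_category \<kappa> B \<and>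
    is_left_kan_extension B C (SET \<kappa>) K G F \<eta>)"
  define c where "c = (\<exists>(B :: ('p, 'q) cat) K G \<eta>. category B \<and> locally_small \<kappa> B \<and>
    small_functor \<kappa> B G \<and> is_left_kan_extension B C (SET \<kappa>) K G F \<eta>)"
  define d where "d = small_functor \<kappa> C F"
  have "b" if a: a
  proof -
    obtain S where S: "small_category \<kappa> (full_subcategory C S)"
      and kan: "is_left_kan_extension (full_subcategory C S) C (SET \<kappa>) inclusion (F \<circ>\<^sub>F inclusion) F
        (id_trans (full_subcategory C S) (SET \<kappa>) (F \<circ>\<^sub>F inclusion))"
      using a unfolding a_def by blast
    obtain B :: "('p, 'q) cat" and \<Phi> \<Psi> where "small_category \<kappa> B"
      and "mutually_inverse B (full_subcategory C S) \<Phi> \<Psi>"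
      using ex_relabelling[OF S assms(2,3)] by blast
    then show b unfolding b_def using left_kan_extension_reindex[OF kan] by blast
  qed
  moreover have "c" if b: b
  proof -
    obtain B :: "('p, 'q) cat" and K G \<eta> where B: "small_category \<kappa> B"
      and kan: "is_left_kan_extension B C (SET \<kappa>) K G F \<eta>"
      using b unfolding b_def by blast
    have G: "is_functor B (SET \<kappa>) G"
      using kan by (simp add: is_left_kan_extension_def nat_trans_def)
    show c
      unfolding c_def using B kan small_functor_on_small_category[OF universe B G]
      by (auto simp: small_category_def)
  qed
  moreover have "d" if c: c
  proof -
    obtain B :: "('p, 'q) cat" and K G \<eta> where B: "category B" "locally_small \<kappa> B"
      and G: "small_functor \<kappa> B G" and kan: "is_left_kan_extension B C (SET \<kappa>) K G F \<eta>"
      using c unfolding c_def by blast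
    interpret B: locally_small_category B \<kappa>
      using universe B by (simp add: locally_small_category_def locally_small_category_axioms_def)
    have "is_functor B (SET \<kappa>) G" using G by (simp add: small_functor_def)
    then obtain J :: "('u, 'u) cat" and D e where J: "small_category \<kappa> J"
      and "freely_generated \<kappa> J B D G e"
      using B.small_functor_iff_freely_generated G by blast
    then show d
      unfolding d_def small_functor_iff_freely_generated[OF assms(6)]
      using freely_generated_left_kan_extension[OF _ kan] by blast
  qed
  moreover have "a" if d: d
  proof -
    obtain J :: "('u, 'u) cat" and D e where J: "small_category \<kappa> J"
      and free: "freely_generated \<kappa> J C D F e"
      using d small_functor_iff_freely_generated[OF assms(6)] unfolding d_def by blast
    \<comment> \<open>The objects at which the generators of \<open>F\<close> live.\<close>
    let ?S = "OMap D ` Obj J"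
    have S: "?S \<subseteq> Obj C" using free is_functor.omap_in by (fastforce simp: freely_generated_def)
    have "small \<kappa> ?S" using J small_image by (auto simp: small_category_def)
    then show a
      unfolding a_def
      using S small_full_subcategory[OF S] left_kan_extension_of_restriction[OF free S] by blast
  qed
  ultimately have "(a \<longleftrightarrow> b) \<and> (b \<longleftrightarrow> c) \<and> (c \<longleftrightarrow> d)" by blast
  then show ?thesis unfolding Let_def a_def b_def c_def d_def .
qed

end
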